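(* Let $X$ and $Y$ be finite connected multigraphs with no vertices of degree one, and let $Y/X$ be an abelian cover of multigraphs with automorphism group $G\simeq\mathbb{Z}/2\mathbb{Z}\times\mathbb{Z}/2\mathbb{Z}$. Let $X_2,X_3,X_4$ be the three intermediate double covers of $X$. Then $$\kappa_Y = 2\cdot\frac{\kappa_{X_2}\,\kappa_{X_3}\,\kappa_{X_4}}{\kappa_X^{2}}.$$
   Context: A multigraph $X$ consists of a set $V_X$ of vertices and a multiset $E_X$ of unordered pairs of vertices (edges); loops and multiple edges are allowed. The degree of a vertex is the number of edges incident to it, each loop counted twice. $\kappa_X$ is the number of spanning trees of $X$ (parallel edges being distinguished). Multigraphs are viewed as one-dimensional CW-complexes. A cover $Y/X$ of multigraphs is a topological covering map $\pi:Y\to X$ that is a morphism of multigraphs; $\mathrm{Aut}(Y/X)$ is its group of deck transformations. The cover is Galois if $\mathrm{Aut}(Y/X)$ acts transitively on each fiber, and abelian if moreover $G=\mathrm{Aut}(Y/X)$ is abelian. The intermediate double covers of $X$ are the quotients $Y/H$, where $H$ runs over the three subgroups of $G$ of order $2$ (equivalently of index $2$); each $Y/H\to X$ is a cover of degree $2$. *)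

theory Defs
  imports "HOL-Analysis.Analysis" "HOL-Combinatorics.Permutations"
    "HOL-Algebra.Elementary_Groups"
begin

section \<open>Multigraphs\<close>

text \<open>
  A multigraph is given by its vertices and its darts, that is, its edges equipped with one of
  their two directions. The map \<open>flip\<close> reverses the direction of a dart, and the edges are the
  pairs \<open>{d, flip d}\<close>, with end points \<open>org d\<close> and \<open>org (flip d)\<close>. Parallel edges are different
  pairs of darts, and a loop is a pair of two different darts with the same origin.
\<close>

record ('v, 'd) mgraph =
  verts :: "'v set"
  darts :: "'d set"
  org :: "'d \<Rightarrow> 'v"
  flip :: "'d \<Rightarrow> 'd"

locale multigraph =
  fixes G :: "('v, 'd) mgraph"
  assumes org_in_verts: "d \<in> darts G \<Longrightarrow> org G d \<in> verts G"
    and flip_in_darts: "d \<in> darts G \<Longrightarrow> flip G d \<in> darts G"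
    and flip_flip: "d \<in> darts G \<Longrightarrow> flip G (flip G d) = d"
    and flip_neq: "d \<in> darts G \<Longrightarrow> flip G d \<noteq> d"

locale finite_multigraph = multigraph +
  assumes finite_verts: "finite (verts G)"
    and finite_darts: "finite (darts G)"

definition underlying_edge :: "('v, 'd) mgraph \<Rightarrow> 'd \<Rightarrow> 'd set"
  where "underlying_edge G d = {d, flip G d}"

definition edges :: "('v, 'd) mgraph \<Rightarrow> 'd set set"
  where "edges G = underlying_edge G ` darts G"

text \<open>Both darts of a loop start at its vertex, so a loop is counted twice.\<close>

definition vdegree :: "('v, 'd) mgraph \<Rightarrow> 'v \<Rightarrow> nat"
  where "vdegree G v = card {d \<in> darts G. org G d = v}"

fun walk :: "('v, 'd) mgraph \<Rightarrow> 'v \<Rightarrow> 'd list \<Rightarrow> 'v \<Rightarrow> bool"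
  where
    "walk G u [] v \<longleftrightarrow> u \<in> verts G \<and> u = v"
  | "walk G u (d # ds) v \<longleftrightarrow> d \<in> darts G \<and> org G d = u \<and> walk G (org G (flip G d)) ds v"

definition connected_graph :: "('v, 'd) mgraph \<Rightarrow> bool"
  where "connected_graph G \<longleftrightarrow>
    verts G \<noteq> {} \<and> (\<forall>u\<in>verts G. \<forall>v\<in>verts G. \<exists>ds. walk G u ds v)"

text \<open>
  The edges of a cycle have to be different: the path \<open>[d, flip d]\<close> back and forth along an edge
  is not a cycle, whereas a loop and a pair of parallel edges are.
\<close>

definition cycle :: "('v, 'd) mgraph \<Rightarrow> 'd list \<Rightarrow> bool"
  where "cycle G ds \<longleftrightarrow> ds \<noteq> [] \<and> (\<exists>u. walk G u ds u) \<and>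
    distinct (map (org G) ds) \<and> distinct (map (underlying_edge G) ds)"

definition tree_graph :: "('v, 'd) mgraph \<Rightarrow> bool"
  where "tree_graph G \<longleftrightarrow> connected_graph G \<and> (\<nexists>ds. cycle G ds)"

definition spanning_trees :: "('v, 'd) mgraph \<Rightarrow> 'd set set set"
  where "spanning_trees G = {T. T \<subseteq> edges G \<and> tree_graph (G\<lparr>darts := \<Union>T\<rparr>)}"

definition kappa :: "('v, 'd) mgraph \<Rightarrow> nat"
  where "kappa G = card (spanning_trees G)"


section \<open>Morphisms\<close>

text \<open>A morphism consists of a map on vertices and a map on darts.\<close>

type_synonym ('w, 'c, 'v, 'd) mgraph_map = "('w \<Rightarrow> 'v) \<times> ('c \<Rightarrow> 'd)"

definition morphism ::
    "('w, 'c) mgraph \<Rightarrow> ('v, 'd) mgraph \<Rightarrow> ('w, 'c, 'v, 'd) mgraph_map \<Rightarrow> bool"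
  where "morphism G H f \<longleftrightarrow>
    (\<forall>v\<in>verts G. fst f v \<in> verts H) \<and>
    (\<forall>d\<in>darts G. snd f d \<in> darts H \<and>
       org H (snd f d) = fst f (org G d) \<and>
       flip H (snd f d) = snd f (flip G d))"


section \<open>Multigraphs as one-dimensional CW-complexes\<close>

text \<open>
  The point at parameter \<open>t\<close> on the dart \<open>d\<close> is the point at parameter \<open>1 - t\<close> on \<open>flip d\<close>.
  A point in the interior of an edge is therefore encoded as the set
  \<open>{(d, t), (flip d, 1 - t)}\<close>, which does not depend on a choice of direction.
\<close>

datatype ('v, 'd) point = Vertex 'v | Inner "('d \<times> real) set"

definition dart_point :: "('v, 'd) mgraph \<Rightarrow> 'd \<Rightarrow> real \<Rightarrow> ('v, 'd) point"
  where "dart_point G d t =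
    (if t \<le> 0 then Vertex (org G d)
     else if t \<ge> 1 then Vertex (org G (flip G d))
     else Inner {(d, t), (flip G d, 1 - t)})"

definition points :: "('v, 'd) mgraph \<Rightarrow> ('v, 'd) point set"
  where "points G = Vertex ` verts G \<union> {dart_point G d t | d t. d \<in> darts G \<and> t \<in> {0..1}}"

text \<open>
  The weak topology: \<open>dart_point G d\<close> is the characteristic map of a 1-cell, and a set is open iff
  its preimage under all characteristic maps is open.
\<close>

definition realization :: "('v, 'd) mgraph \<Rightarrow> ('v, 'd) point topology"
  where "realization G = topology (\<lambda>U. U \<subseteq> points G \<and>
    (\<forall>d\<in>darts G. openin (top_of_set {0..1}) {t \<in> {0..1}. dart_point G d t \<in> U}))"

lemma openin_realization:
  "openin (realization G) U \<longleftrightarrow> U \<subseteq> points G \<and>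
    (\<forall>d\<in>darts G. openin (top_of_set {0..1}) {t \<in> {0..1}. dart_point G d t \<in> U})"
proof -
  let ?P = "\<lambda>U. U \<subseteq> points G \<and>
    (\<forall>d\<in>darts G. openin (top_of_set {0..1}) {t \<in> {0..1}. dart_point G d t \<in> U})"
  have Int: "{t \<in> {0..1}. dart_point G d t \<in> S \<inter> T} =
      {t \<in> {0..1}. dart_point G d t \<in> S} \<inter> {t \<in> {0..1}. dart_point G d t \<in> T}" for d S T
    by auto
  have Un: "{t \<in> {0..1}. dart_point G d t \<in> \<Union>K} =
      (\<Union>S\<in>K. {t \<in> {0..1}. dart_point G d t \<in> S})" for d K
    by auto
  have "istopology ?P"
    unfolding istopology_def Int Un by blast
  then show ?thesis
    by (simp add: realization_def topology_inverse')
qed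

lemma topspace_realization: "topspace (realization G) = points G"
proof -
  have "{t \<in> {0..1::real}. dart_point G d t \<in> points G} = {0..1}" if "d \<in> darts G" for d
    using that by (auto simp: points_def)
  then have "openin (realization G) (points G)"
    by (simp add: openin_realization)
  then show ?thesis
    using openin_realization by (metis openin_subset openin_topspace subset_antisym)
qed

primrec realization_map ::
    "('w, 'c, 'v, 'd) mgraph_map \<Rightarrow> ('w, 'c) point \<Rightarrow> ('v, 'd) point"
  where
    "realization_map f (Vertex v) = Vertex (fst f v)"
  | "realization_map f (Inner S) = Inner (map_prod (snd f) id ` S)"

lemma realization_map_dart_point:
  assumes "multigraph G" "morphism G H f" "d \<in> darts G"
  shows "realization_map f (dart_point G d t) = dart_point H (snd f d) t"
  using assms multigraph.flip_in_darts[of G d]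
  by (auto simp: dart_point_def morphism_def)


section \<open>Covers and deck transformations\<close>

text \<open>The analogue of \<^const>\<open>covering_space\<close> for abstract topologies.\<close>

definition covering_map :: "'a topology \<Rightarrow> 'b topology \<Rightarrow> ('a \<Rightarrow> 'b) \<Rightarrow> bool"
  where "covering_map T S p \<longleftrightarrow>
    continuous_map T S p \<and> p ` topspace T = topspace S \<and>
    (\<forall>x \<in> topspace S. \<exists>U. x \<in> U \<and> openin S U \<and>
       (\<exists>\<V>. \<Union>\<V> = {y \<in> topspace T. p y \<in> U} \<and>
            (\<forall>V\<in>\<V>. openin T V) \<and>
            pairwise disjnt \<V> \<and>
            (\<forall>V\<in>\<V>. homeomorphic_map (subtopology T V) (subtopology S U) p)))"

definition graph_cover ::
    "('w, 'c) mgraph \<Rightarrow> ('v, 'd) mgraph \<Rightarrow> ('w, 'c, 'v, 'd) mgraph_map \<Rightarrow> bool"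
  where "graph_cover Y X p \<longleftrightarrow>
    morphism Y X p \<and> covering_map (realization Y) (realization X) (realization_map p)"

text \<open>
  The deck transformations, as automorphisms of the multigraph \<open>Y\<close> over its base. The use of
  \<^const>\<open>permutes\<close> makes them the identity outside \<open>verts Y\<close> and \<open>darts Y\<close>, so that different
  elements of the carrier are different automorphisms.
\<close>

definition deck_group ::
    "('w, 'c) mgraph \<Rightarrow> ('w, 'c, 'v, 'd) mgraph_map \<Rightarrow> ('w, 'c, 'w, 'c) mgraph_map monoid"
  where "deck_group Y p =
    \<lparr>carrier = {s. morphism Y Y s \<and> fst s permutes verts Y \<and> snd s permutes darts Y \<and>
        (\<forall>v\<in>verts Y. fst p (fst s v) = fst p v) \<and>
        (\<forall>d\<in>darts Y. snd p (snd s d) = snd p d)},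
     mult = (\<lambda>s t. (fst s \<circ> fst t, snd s \<circ> snd t)),
     one = (id, id)\<rparr>"

definition galois_cover ::
    "('w, 'c) mgraph \<Rightarrow> ('v, 'd) mgraph \<Rightarrow> ('w, 'c, 'v, 'd) mgraph_map \<Rightarrow> bool"
  where "galois_cover Y X p \<longleftrightarrow> graph_cover Y X p \<and>
    (\<forall>y \<in> topspace (realization Y). \<forall>y' \<in> topspace (realization Y).
       realization_map p y = realization_map p y' \<longrightarrow>
       (\<exists>s \<in> carrier (deck_group Y p). realization_map s y = y'))"

definition abelian_cover ::
    "('w, 'c) mgraph \<Rightarrow> ('v, 'd) mgraph \<Rightarrow> ('w, 'c, 'v, 'd) mgraph_map \<Rightarrow> bool"
  where "abelian_cover Y X p \<longleftrightarrow> galois_cover Y X p \<and> comm_group (deck_group Y p)"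

text \<open>
  The quotient of \<open>Y\<close> by a group \<open>H\<close> of automorphisms; vertices and darts are the \<open>H\<close>-orbits. As
  \<open>H\<close> commutes with \<open>org\<close> and \<open>flip\<close>, the image of the orbit of \<open>d\<close> under \<open>org\<close> (or \<open>flip\<close>) is the
  orbit of \<open>org d\<close> (or \<open>flip d\<close>).
\<close>

definition quotient_graph ::
    "('w, 'c) mgraph \<Rightarrow> ('w, 'c, 'w, 'c) mgraph_map set \<Rightarrow> ('w set, 'c set) mgraph"
  where "quotient_graph Y H =
    \<lparr>verts = (\<lambda>v. {fst s v | s. s \<in> H}) ` verts Y,
     darts = (\<lambda>d. {snd s d | s. s \<in> H}) ` darts Y,
     org = (\<lambda>D. org Y ` D),
     flip = (\<lambda>D. flip Y ` D)\<rparr>"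

end

(*
  For a multigraph with Laplacian L put P(t) = det (t + L). Expanding every row over the darts
  leaving its vertex (or the choice of being a root) shows that P(t) is the sum of t^(number of
  roots) over all rooted spanning forests: a choice of one dart per non-root contributes 1 if it
  has no cycle, and 0 otherwise. Hence P(t) = t Q(t), where Q(0) is the number of vertices times
  kappa.

  On a cover with group Z/2 x Z/2 the matrix t + L is block circulant, so P_Y is a product of four
  determinants indexed by the characters of the group. P_X is the factor of the trivial character,
  and the P of the double cover Y/H is the product of the two factors whose characters are trivial
  on H. This gives P_Y P_X^2 = P_X2 P_X3 P_X4. Dividing by t^3 and letting t tend to 0 gives the
  claim, since Y has 4 n, the double covers 2 n, and X has n vertices.
*)

theory Submission
  imports "Jordan_Normal_Form.Determinant" Defs
begin

section \<open>Determinants indexed by finite sets\<close>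

text \<open>The shift by \<open>t\<close> is what makes the determinants carry information: a
  Laplacian is singular, so at \<open>t = 0\<close> the product formula only reads 0 = 0. Two points
  must be settled before linear algebra applies. The cover is topological, and what is extracted
  from it is its behaviour near a vertex: the darts leaving a vertex correspond to those leaving its
  image. Moreover a nontrivial deck transformation must fix no vertex, which follows from unique
  lifting of walks in the connected graph Y, and must not reverse an edge, so that the quotients are
  multigraphs again. The double covers are approached from above, as targets of Y -> Y/H. In this
  way one statement about summing rows of the Laplacian over fibres serves X, the three quotients
  and the automorphisms of Y.\<close>

definition set_det :: "'a set \<Rightarrow> ('a \<Rightarrow> 'a \<Rightarrow> 'r::comm_ring_1) \<Rightarrow> 'r"
  where "set_det V M = (\<Sum>\<pi> | \<pi> permutes V. of_int (sign \<pi>) * (\<Prod>v\<in>V. M v (\<pi> v)))"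

lemma set_det_cong:
  assumes "\<And>u v. u \<in> V \<Longrightarrow> v \<in> V \<Longrightarrow> M u v = N u v"
  shows "set_det V M = set_det V N"
  unfolding set_det_def
  by (intro sum.cong arg_cong2[where f = "(*)"] prod.cong refl)
    (use assms in \<open>auto simp: permutes_in_image\<close>)

text \<open>Conjugation by \<open>h\<close> matches the permutations of \<open>A\<close> with those
  of \<open>B\<close> and preserves signs and factors.\<close>

lemma set_det_reindex:
  assumes h: "bij_betw h A B" and A: "finite A"
  shows "set_det B M = set_det A (\<lambda>i j. M (h i) (h j))"
proof -
  have hA: "inj_on h A" and B: "B = h ` A"
    using h by (auto simp: bij_betw_def)
  let ?g = "inv_into A h"
  have g: "bij_betw ?g B A" using h by (rule bij_betw_inv_into)
  have gi: "inj_on ?g B" using g by (auto simp: bij_betw_def)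
  show ?thesis
    unfolding set_det_def
  proof (rule sum.reindex_bij_witness[of _ "map_permutation A h" "map_permutation B ?g"])
    fix \<pi> assume "\<pi> \<in> {\<pi>. \<pi> permutes B}"
    then have \<pi>: "\<pi> permutes B" by simp
    show "map_permutation A h (map_permutation B ?g \<pi>) = \<pi>"
      using map_permutation_compose_inv[OF g \<pi>] h by (metis B f_inv_into_f)
    show p: "map_permutation B ?g \<pi> \<in> {\<pi>. \<pi> permutes A}"
      using map_permutation_permutes[OF g \<pi>] by simp
    have s: "sign (map_permutation B ?g \<pi>) = sign \<pi>"
      using gi \<pi> A B by (auto intro: sign_map_permutation)
    have "(\<Prod>v\<in>B. M v (\<pi> v)) = (\<Prod>i\<in>A. M (h i) (\<pi> (h i)))"
      by (simp add: B prod.reindex[OF hA])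
    also have "\<dots> = (\<Prod>i\<in>A. M (h i) (h (map_permutation B ?g \<pi> i)))"
    proof (rule prod.cong[OF refl])
      fix i assume i: "i \<in> A"
      have "map_permutation B ?g \<pi> (?g (h i)) = ?g (\<pi> (h i))"
        using map_permutation_apply[OF gi] i B by auto
      moreover have "?g (h i) = i" using i hA by simp
      moreover have "\<pi> (h i) \<in> B" using \<pi> i B by (simp add: permutes_in_image)
      ultimately show "M (h i) (\<pi> (h i)) = M (h i) (h (map_permutation B ?g \<pi> i))"
        using B by (metis f_inv_into_f)
    qed
    finally show "of_int (sign (map_permutation B ?g \<pi>)) *
        (\<Prod>v\<in>A. M (h v) (h (map_permutation B ?g \<pi> v))) =
      of_int (sign \<pi>) * (\<Prod>v\<in>B. M v (\<pi> v))"
      using s by simp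
  next
    fix \<pi> assume "\<pi> \<in> {\<pi>. \<pi> permutes A}"
    then have \<pi>: "\<pi> permutes A" by simp
    show "map_permutation B ?g (map_permutation A h \<pi>) = \<pi>"
      using map_permutation_compose_inv[OF h \<pi>] hA by simp
    show "map_permutation A h \<pi> \<in> {\<pi>. \<pi> permutes B}"
      using map_permutation_permutes[OF h \<pi>] by simp
  qed
qed

text \<open>The bridge to matrices, whose rows are numbered from 0. Together with an enumeration of
  the index set it transfers matrix facts to \<open>set_det\<close>.\<close>

lemma det_mat_eq_set_det:
  "Determinant.det (Matrix.mat n n (\<lambda>(i, j). M i j)) = set_det {0..<n} M"
  by (subst det_def'[of _ n])
    (auto simp: set_det_def permutes_in_image intro!: sum.cong prod.cong arg_cong2[where f = "(*)"])

lemma set_det_eq_0: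
  fixes M :: "'a \<Rightarrow> 'a \<Rightarrow> 'r::field"
  assumes V: "finite V" and w: "w \<in> V" "x w \<noteq> 0"
    and ker: "\<And>u. u \<in> V \<Longrightarrow> (\<Sum>v\<in>V. M u v * x v) = 0"
  shows "set_det V M = 0"
proof -
  obtain h where h: "bij_betw h {0..<card V} V"
    using ex_bij_betw_nat_finite[OF V] by blast
  let ?n = "card V"
  let ?A = "Matrix.mat ?n ?n (\<lambda>(i, j). M (h i) (h j))"
  let ?x = "Matrix.vec ?n (\<lambda>i. x (h i))"
  have "w \<in> h ` {0..<?n}"
    using w(1) bij_betw_imp_surj_on[OF h] by simp
  then obtain i where i: "i < ?n" "h i = w"
    by auto
  have "?x $ i \<noteq> (0\<^sub>v ?n) $ i"
    using i w by simp
  then have "?x \<noteq> 0\<^sub>v ?n"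
    by metis
  moreover have "?A *\<^sub>v ?x = 0\<^sub>v ?n"
  proof (rule eq_vecI)
    fix i assume i: "i < dim_vec (0\<^sub>v ?n :: 'r Matrix.vec)"
    have "(\<Sum>j = 0..<?n. M (h i) (h j) * x (h j)) = (\<Sum>v\<in>V. M (h i) v * x v)"
      by (rule sum.reindex_bij_betw[OF h])
    also have "\<dots> = 0"
      using h i by (intro ker) (auto simp: bij_betw_def)
    finally show "(?A *\<^sub>v ?x) $ i = (0\<^sub>v ?n) $ i"
      using i by (simp add: scalar_prod_def)
  qed simp
  ultimately have "Determinant.det ?A = 0"
    by (subst det_0_iff_vec_prod_zero[of _ ?n]) (auto intro!: exI[of _ ?x])
  then show ?thesis
    by (simp add: set_det_reindex[OF h] det_mat_eq_set_det)
qed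

text \<open>Adding the second block row to the first and then subtracting the first block column
  from the second gives a block triangular matrix with diagonal blocks \<open>A + B\<close> and
  \<open>A - B\<close>. Both operations are multiplications by matrices of determinant 1, and
  \<open>A\<close> and \<open>B\<close> may fail to commute.\<close>

lemma det_four_block_circulant:
  fixes A B :: "'r::idom mat"
  assumes A: "A \<in> carrier_mat n n" and B: "B \<in> carrier_mat n n"
  shows "Determinant.det (four_block_mat A B B A) =
    Determinant.det (A + B) * Determinant.det (A - B)"
proof -
  let ?I = "1\<^sub>m n :: 'r mat" and ?O = "0\<^sub>m n n :: 'r mat"
  let ?P = "four_block_mat ?I ?I ?O ?I" and ?Q = "four_block_mat ?I (- ?I) ?O ?I"
  let ?M = "four_block_mat A B B A"
  have carr: "?P \<in> carrier_mat (n + n) (n + n)" "?Q \<in> carrier_mat (n + n) (n + n)"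
    "?M \<in> carrier_mat (n + n) (n + n)"
    using A B by auto
  have I: "?I \<in> carrier_mat n n" "- ?I \<in> carrier_mat n n" "?O \<in> carrier_mat n n" by auto
  have PM: "?P * ?M = four_block_mat (A + B) (B + A) B A"
    using A B by (subst mult_four_block_mat[OF I(1) I(1) I(3) I(1) A B B A]) auto
  have AB: "A + B \<in> carrier_mat n n" "B + A \<in> carrier_mat n n"
    using A B by auto
  have "?P * ?M * ?Q = four_block_mat (A + B) ?O B (A - B)"
    unfolding PM
    apply (subst mult_four_block_mat[OF AB B A I(1) I(2) I(3) I(1)])
    apply (rule cong_four_block_mat)
    using A B by (auto intro!: eq_matI)
  then have "Determinant.det (?P * ?M * ?Q) = Determinant.det (A + B) * Determinant.det (A - B)"
    using det_four_block_mat_upper_right_zero[OF AB(1) refl B minus_carrier_mat[OF B]] A B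
    by simp
  moreover have "Determinant.det ?P = 1" "Determinant.det ?Q = 1"
    by (simp_all add: det_four_block_mat_lower_left_zero[of _ n _ n])
  ultimately show ?thesis
    using carr by (simp add: det_mult[of _ "n + n"])
qed

text \<open>The matrix is invariant under exchanging the two sheets; the factors belong to the two
  characters of Z/2.\<close>

lemma set_det_double:
  fixes A B :: "'a \<Rightarrow> 'a \<Rightarrow> 'r::idom"
  assumes V: "finite V"
  shows "set_det (V \<times> (UNIV :: bool set))
      (\<lambda>(u, i) (v, j). if i = j then A u v else B u v) =
    set_det V (\<lambda>u v. A u v + B u v) * set_det V (\<lambda>u v. A u v - B u v)"
    (is "set_det _ ?M = _")
proof -
  let ?n = "card V"
  obtain h where h: "bij_betw h {0..<?n} V"
    using ex_bij_betw_nat_finite[OF V] by blast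
  have hV: "h i \<in> V" if "i < ?n" for i
    using h that by (auto simp: bij_betw_def)
  have hinj: "i = j" if "h i = h j" "i < ?n" "j < ?n" for i j
    using h that by (auto simp: bij_betw_def inj_on_def)
  \<comment> \<open>The \<open>False\<close> sheet is enumerated before the \<open>True\<close>
    sheet, which turns the Boolean pattern into four blocks of size \<open>?n\<close>.\<close>
  define k where "k i = (if i < ?n then (h i, False) else (h (i - ?n), True))" for i
  have "bij_betw k {0..<?n + ?n} (V \<times> UNIV)"
  proof (rule bij_betw_imageI)
    show "inj_on k {0..<?n + ?n}"
    proof (rule inj_onI)
      fix i j assume ij: "i \<in> {0..<?n + ?n}" "j \<in> {0..<?n + ?n}" and k: "k i = k j"
      consider "i < ?n" "j < ?n" | "i \<ge> ?n" "j \<ge> ?n"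
        using k by (force simp: k_def split: if_splits)
      then show "i = j"
      proof cases
        case 1
        then show ?thesis using k hinj by (simp add: k_def)
      next
        case 2
        then have "h (i - ?n) = h (j - ?n)" using k by (simp add: k_def)
        moreover have "i - ?n < ?n" "j - ?n < ?n" using 2 ij by auto
        ultimately have "i - ?n = j - ?n" by (rule hinj)
        then show ?thesis using 2 by simp
      qed
    qed
    show "k ` {0..<?n + ?n} = V \<times> UNIV"
    proof
      show "k ` {0..<?n + ?n} \<subseteq> V \<times> UNIV"
        by (auto simp: k_def intro!: hV)
      have "(v, b) \<in> k ` {0..<?n + ?n}" if "v \<in> V" for v b
      proof -
        have "v \<in> h ` {0..<?n}"
          using that bij_betw_imp_surj_on[OF h] by simp
        then obtain i where i: "i < ?n" "v = h i"
          by auto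
        show ?thesis
          by (rule image_eqI[of _ _ "if b then i + ?n else i"]) (use i in \<open>auto simp: k_def\<close>)
      qed
      then show "V \<times> UNIV \<subseteq> k ` {0..<?n + ?n}" by auto
    qed
  qed
  then have "set_det (V \<times> UNIV) ?M =
      Determinant.det (Matrix.mat (?n + ?n) (?n + ?n) (\<lambda>(i, j). ?M (k i) (k j)))"
    by (simp add: set_det_reindex det_mat_eq_set_det)
  also have "Matrix.mat (?n + ?n) (?n + ?n) (\<lambda>(i, j). ?M (k i) (k j)) =
      four_block_mat (Matrix.mat ?n ?n (\<lambda>(i, j). A (h i) (h j)))
        (Matrix.mat ?n ?n (\<lambda>(i, j). B (h i) (h j)))
        (Matrix.mat ?n ?n (\<lambda>(i, j). B (h i) (h j)))
        (Matrix.mat ?n ?n (\<lambda>(i, j). A (h i) (h j)))"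
    by (rule eq_matI) (auto simp: k_def)
  also have "Determinant.det \<dots> =
      Determinant.det (Matrix.mat ?n ?n (\<lambda>(i, j). A (h i) (h j) + B (h i) (h j))) *
      Determinant.det (Matrix.mat ?n ?n (\<lambda>(i, j). A (h i) (h j) - B (h i) (h j)))"
    by (subst det_four_block_circulant[of _ ?n])
      (auto intro!: arg_cong2[where f = "(*)"] arg_cong[where f = Determinant.det] eq_matI)
  finally show ?thesis
    by (simp add: set_det_reindex[OF h] det_mat_eq_set_det)
qed

section \<open>The Laplacian and rooted forests\<close>

abbreviation head :: "('v, 'd) mgraph \<Rightarrow> 'd \<Rightarrow> 'v"
  where "head G d \<equiv> org G (flip G d)"

definition out_darts :: "('v, 'd) mgraph \<Rightarrow> 'v \<Rightarrow> 'd set"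
  where "out_darts G v = {d \<in> darts G. org G d = v}"

text \<open>Degree matrix minus adjacency matrix, plus \<open>t\<close> times the identity, written
  dart by dart so that a row is visibly a sum with one term per possible choice. A dart of a loop
  contributes 0.\<close>

definition shifted_laplacian :: "('v, 'd) mgraph \<Rightarrow> 'r::comm_ring_1 \<Rightarrow> 'v \<Rightarrow> 'v \<Rightarrow> 'r"
  where "shifted_laplacian G t u v = t * of_bool (u = v) +
    (\<Sum>d\<in>out_darts G u. of_bool (u = v) - of_bool (head G d = v))"

text \<open>The value \<open>None\<close> makes a vertex a root; otherwise the dart points to the parent.\<close>

definition dart_choices :: "('v, 'd) mgraph \<Rightarrow> ('v \<Rightarrow> 'd option) set"
  where "dart_choices G = (\<Pi>\<^sub>E v\<in>verts G. insert None (Some ` out_darts G v))"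

text \<open>Parents stand on the left, so well-foundedness says that following the chosen darts
  always ends at a root.\<close>

definition parent_rel :: "('v, 'd) mgraph \<Rightarrow> ('v \<Rightarrow> 'd option) \<Rightarrow> ('v \<times> 'v) set"
  where "parent_rel G f = {(head G d, v) | v d. v \<in> verts G \<and> f v = Some d}"

definition rooted_forests :: "('v, 'd) mgraph \<Rightarrow> ('v \<Rightarrow> 'd option) set"
  where "rooted_forests G = {f \<in> dart_choices G. wf (parent_rel G f)}"

definition roots :: "('v, 'd) mgraph \<Rightarrow> ('v \<Rightarrow> 'd option) \<Rightarrow> 'v set"
  where "roots G f = {v \<in> verts G. f v = None}"

definition choice_matrix ::
    "('v, 'd) mgraph \<Rightarrow> 'r::comm_ring_1 \<Rightarrow> ('v \<Rightarrow> 'd option) \<Rightarrow> 'v \<Rightarrow> 'v \<Rightarrow> 'r"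
  where "choice_matrix G t f u v = (case f u of None \<Rightarrow> t * of_bool (u = v)
    | Some d \<Rightarrow> of_bool (u = v) - of_bool (head G d = v))"

lemma dart_choicesD:
  assumes "f \<in> dart_choices G" "v \<in> verts G" "f v = Some d"
  shows "d \<in> darts G" "org G d = v"
  using assms by (auto simp: dart_choices_def out_darts_def PiE_iff dest!: bspec)

context finite_multigraph
begin

lemma finite_out_darts: "finite (out_darts G v)"
  using finite_darts by (simp add: out_darts_def)

lemma finite_dart_choices: "finite (dart_choices G)"
  unfolding dart_choices_def using finite_verts finite_out_darts by (intro finite_PiE) auto

lemma head_in_verts: "d \<in> darts G \<Longrightarrow> head G d \<in> verts G"
  by (simp add: org_in_verts flip_in_darts)

lemma parent_relD:
  assumes "f \<in> dart_choices G" "(u, v) \<in> parent_rel G f"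
  shows "u \<in> verts G" "v \<in> verts G"
  using assms dart_choicesD[OF assms(1)] head_in_verts by (auto simp: parent_rel_def)

lemma finite_parent_rel:
  assumes "f \<in> dart_choices G"
  shows "finite (parent_rel G f)"
  by (rule finite_subset[of _ "verts G \<times> verts G"])
    (use parent_relD[OF assms] finite_verts in auto)

lemma set_det_shifted_laplacian_choices:
  "set_det (verts G) (shifted_laplacian G t) =
    (\<Sum>f\<in>dart_choices G. set_det (verts G) (choice_matrix G t f))"
proof -
  let ?c = "\<lambda>u v c. case c of None \<Rightarrow> t * of_bool (u = v)
      | Some d \<Rightarrow> of_bool (u = v) - of_bool (head G d = v)"
  have row: "shifted_laplacian G t u v = (\<Sum>c\<in>insert None (Some ` out_darts G u). ?c u v c)"
    for u v
    by (subst sum.insert)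
      (auto simp: shifted_laplacian_def finite_out_darts sum.reindex)
  have "(\<Prod>u\<in>verts G. shifted_laplacian G t u (\<pi> u)) =
      (\<Sum>f\<in>dart_choices G. \<Prod>u\<in>verts G. choice_matrix G t f u (\<pi> u))" for \<pi>
    unfolding row choice_matrix_def dart_choices_def
    by (rule prod_sum_PiE) (auto simp: finite_verts finite_out_darts)
  then show ?thesis
    unfolding set_det_def sum_distrib_left by (subst sum.swap) (simp add: sum_distrib_left)
qed

text \<open>With parents listed before children the matrix is triangular; its diagonal has
  \<open>t\<close> at the roots and 1 elsewhere.\<close>

lemma set_det_choice_matrix_forest:
  assumes f: "f \<in> rooted_forests G"
  shows "set_det (verts G) (choice_matrix G t f) = t ^ card (roots G f)"
proof -
  have wf: "wf (parent_rel G f)" using f by (simp add: rooted_forests_def)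
  have no_loop: "head G d \<noteq> v" if "v \<in> verts G" "f v = Some d" for v d
  proof
    assume "head G d = v"
    then have "(v, v) \<in> parent_rel G f" using that by (auto simp: parent_rel_def)
    then show False using wf by (meson wf_not_refl)
  qed
  have zero: "(\<Prod>v\<in>verts G. choice_matrix G t f v (\<pi> v)) = 0"
    if \<pi>: "\<pi> permutes verts G" and "\<pi> \<noteq> id" for \<pi>
  proof -
    obtain w where "\<pi> w \<noteq> w" using \<open>\<pi> \<noteq> id\<close> by fastforce
    then have "w \<in> {v. \<pi> v \<noteq> v}" by simp
    \<comment> \<open>A minimal moved vertex \<open>v\<close> exposes a zero factor:
      \<open>\<pi> v\<close> is moved as well, so by minimality it is not the parent of
      \<open>v\<close>, and it is not \<open>v\<close> either.\<close>
    from wfE_min[OF wf this] obtain v where v: "\<pi> v \<noteq> v"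
      and min: "\<And>u. (u, v) \<in> parent_rel G f \<Longrightarrow> \<pi> u = u"
      by auto
    have vV: "v \<in> verts G" using \<pi> v by (meson permutes_not_in)
    have "\<pi> (\<pi> v) \<noteq> \<pi> v"
      using v permutes_inj[OF \<pi>] by (auto dest: injD)
    then have "(\<pi> v, v) \<notin> parent_rel G f" using min by blast
    then have "choice_matrix G t f v (\<pi> v) = 0"
      using v vV unfolding choice_matrix_def parent_rel_def
      by (cases "f v") (simp_all add: eq_commute[of _ "\<pi> v"])
    then show ?thesis
      using vV finite_verts by (intro prod_zero) auto
  qed
  have "set_det (verts G) (choice_matrix G t f) =
      (\<Sum>\<pi>\<in>{id}. of_int (sign \<pi>) * (\<Prod>v\<in>verts G. choice_matrix G t f v (\<pi> v)))"
    unfolding set_det_def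
    by (rule sum.mono_neutral_right)
      (use zero in \<open>auto simp: finite_permutations finite_verts permutes_id\<close>)
  also have "\<dots> = (\<Prod>v\<in>verts G. if f v = None then t else 1)"
    using no_loop by (auto simp: choice_matrix_def intro!: prod.cong split: option.split)
  also have "\<dots> = t ^ card (roots G f)"
    by (simp add: prod.If_cases finite_verts roots_def Int_def)
  finally show ?thesis .
qed

text \<open>
  The vertices from which no root is reached support a vector in the kernel.
\<close>

lemma set_det_choice_matrix_not_forest:
  fixes t :: "'r::field"
  assumes f: "f \<in> dart_choices G" and nwf: "\<not> wf (parent_rel G f)"
  shows "set_det (verts G) (choice_matrix G t f) = 0"
proof -
  let ?R = "parent_rel G f"
  let ?B = "- Wellfounded.acc ?R"
  obtain w where w: "w \<in> ?B" using nwf by (auto simp: wf_iff_acc)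
  have "w \<in> verts G"
  proof (rule ccontr)
    assume "w \<notin> verts G"
    then have "y \<in> Wellfounded.acc ?R" if "(y, w) \<in> ?R" for y
      using that by (simp add: parent_rel_def)
    then have "w \<in> Wellfounded.acc ?R" by (rule accI)
    then show False using w by simp
  qed
  moreover have "(\<Sum>v\<in>verts G. choice_matrix G t f u v * of_bool (v \<in> ?B)) = 0"
    if u: "u \<in> verts G" for u
  proof (cases "f u")
    case None
    then have "y \<in> Wellfounded.acc ?R" if "(y, u) \<in> ?R" for y
      using that by (simp add: parent_rel_def)
    then have "u \<in> Wellfounded.acc ?R" by (rule accI)
    then show ?thesis
      by (intro sum.neutral) (auto simp: choice_matrix_def None)
  next
    case (Some d)
    have d: "d \<in> darts G" "org G d = u" using dart_choicesD[OF f u Some] by auto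
    \<comment> \<open>The parent is the only predecessor of \<open>u\<close>, so accessibility
      passes in both directions. Row \<open>u\<close> applied to the vector is therefore 1 - 1 or 0
      - 0.\<close>
    have "u \<in> ?B \<longleftrightarrow> head G d \<in> ?B"
    proof -
      have "(head G d, u) \<in> ?R" using u Some by (auto simp: parent_rel_def)
      moreover have "y = head G d" if "(y, u) \<in> ?R" for y
        using that Some by (auto simp: parent_rel_def)
      ultimately show ?thesis
        by (metis ComplD ComplI accI acc_downward)
    qed
    moreover have "(\<Sum>v\<in>verts G. choice_matrix G t f u v * of_bool (v \<in> ?B)) =
        (\<Sum>v\<in>verts G. of_bool (u = v) * of_bool (v \<in> ?B)) -
        (\<Sum>v\<in>verts G. of_bool (head G d = v) * of_bool (v \<in> ?B))"
      by (simp add: choice_matrix_def Some sum_subtractf left_diff_distrib)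
    ultimately show ?thesis
      using u head_in_verts[OF d(1)] finite_verts
      by (simp add: of_bool_def if_distrib[of "\<lambda>x. x * _"] sum.delta' cong: if_cong)
  qed
  ultimately show ?thesis
    using w by (intro set_det_eq_0[where w = w and x = "\<lambda>v. of_bool (v \<in> ?B)"] finite_verts) auto
qed

lemma set_det_shifted_laplacian:
  fixes t :: "'r::field"
  shows "set_det (verts G) (shifted_laplacian G t) =
    (\<Sum>f\<in>rooted_forests G. t ^ card (roots G f))"
proof -
  have "set_det (verts G) (shifted_laplacian G t) =
      (\<Sum>f\<in>rooted_forests G. set_det (verts G) (choice_matrix G t f))"
    unfolding set_det_shifted_laplacian_choices
    by (rule sum.mono_neutral_right)
      (auto simp: rooted_forests_def finite_dart_choices set_det_choice_matrix_not_forest)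
  then show ?thesis
    by (simp add: set_det_choice_matrix_forest)
qed

end

section \<open>Spanning trees as forests with one root\<close>

definition forest_edges :: "('v, 'd) mgraph \<Rightarrow> ('v \<Rightarrow> 'd option) \<Rightarrow> 'd set set"
  where "forest_edges G f = underlying_edge G ` {d. \<exists>v\<in>verts G. f v = Some d}"

abbreviation restrict_edges :: "('v, 'd) mgraph \<Rightarrow> 'd set set \<Rightarrow> ('v, 'd) mgraph"
  where "restrict_edges G T \<equiv> G\<lparr>darts := \<Union>T\<rparr>"

lemma underlying_edge_darts_update [simp]:
  "underlying_edge (G\<lparr>darts := D\<rparr>) = underlying_edge G"
  by (simp add: underlying_edge_def fun_eq_iff)

section \<open>Walks and their reduction to simple walks\<close>

lemma walk_append:
  assumes "walk G u ds v" "walk G v es w"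
  shows "walk G u (ds @ es) w"
  using assms by (induction ds arbitrary: u) auto

lemma walk_suffix: "walk G u (ds @ d # es) w \<Longrightarrow> walk G (org G d) (d # es) w"
  by (induction ds arbitrary: u) auto

lemma walk_darts: "walk G u ds v \<Longrightarrow> d \<in> set ds \<Longrightarrow> d \<in> darts G"
  by (induction ds arbitrary: u) auto

lemma walk_mono:
  assumes "walk (G\<lparr>darts := D\<rparr>) u ds v" "D \<subseteq> D'"
  shows "walk (G\<lparr>darts := D'\<rparr>) u ds v"
  using assms by (induction ds arbitrary: u) auto

lemma walk_predecessor:
  assumes "walk G u ds v" "d \<in> set ds"
  shows "org G d = u \<or> (\<exists>e\<in>set ds. head G e = org G d)"
  using assms by (induction ds arbitrary: u) fastforce+

lemma walk_successor:
  assumes "walk G u ds v" "d \<in> set ds"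
  shows "head G d = v \<or> (\<exists>e\<in>set ds. org G e = head G d)"
  using assms
proof (induction ds arbitrary: u)
  case (Cons a ds)
  then show ?case by (cases ds) auto
qed simp

lemma walk_end: "walk G u ds v \<Longrightarrow> ds \<noteq> [] \<Longrightarrow> \<exists>e\<in>set ds. head G e = v"
  by (induction ds arbitrary: u) fastforce+

lemma walk_start: "walk G u ds v \<Longrightarrow> ds \<noteq> [] \<Longrightarrow> \<exists>e\<in>set ds. org G e = u"
  by (cases ds) auto

lemma walk_end_in_verts: "walk G u ds v \<Longrightarrow> v \<in> verts G"
  by (induction ds arbitrary: u) auto

text \<open>If the start occurs again as an origin, the walk is cut to begin there. The end is kept
  from being an origin so that a dart from the end back to the start can later close the walk to a
  cycle.\<close>

lemma walk_simple:
  assumes "walk G u ds v"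
  shows "\<exists>es. walk G u es v \<and> distinct (map (org G) es) \<and> v \<notin> org G ` set es"
  using assms
proof (induction ds arbitrary: u)
  case Nil
  then show ?case by (intro exI[of _ "[]"]) auto
next
  case (Cons d ds)
  then obtain es where es: "walk G (head G d) es v" "distinct (map (org G) es)" "v \<notin> org G ` set es"
    by auto
  have d: "d \<in> darts G" "org G d = u" using Cons.prems by auto
  consider "u \<in> org G ` set es" | "u \<notin> org G ` set es" "u = v" | "u \<notin> org G ` set es" "u \<noteq> v"
    by blast
  then show ?case
  proof cases
    case 1
    then obtain e xs ys where e: "es = xs @ e # ys" "org G e = u"
      by (metis image_iff split_list)
    then show ?thesis
      using es walk_suffix[of G _ xs e ys v] by (intro exI[of _ "e # ys"]) auto
  next
    case 2
    then show ?thesis using walk_end_in_verts[OF es(1)] by (intro exI[of _ "[]"]) simp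
  next
    case 3
    then show ?thesis using es d by (intro exI[of _ "d # es"]) auto
  qed
qed

context multigraph
begin

lemma walk_rev:
  assumes "walk G u ds v"
  shows "walk G v (rev (map (flip G) ds)) u"
  using assms
proof (induction ds arbitrary: u)
  case (Cons d ds)
  then have "walk G (head G d) [flip G d] u"
    by (auto simp: flip_in_darts flip_flip org_in_verts)
  then show ?case
    using Cons walk_append by fastforce
qed auto

lemma underlying_edge_flip: "d \<in> darts G \<Longrightarrow> underlying_edge G (flip G d) = underlying_edge G d"
  by (auto simp: underlying_edge_def flip_flip)

lemma underlying_edge_eqD:
  assumes "underlying_edge G d = underlying_edge G e"
  shows "e = d \<or> e = flip G d"
  using assms by (auto simp: underlying_edge_def doubleton_eq_iff)

text \<open>An edge could only recur as \<open>flip G d\<close> after \<open>d\<close>. Since it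
  starts at the head of \<open>d\<close>, distinctness of origins makes it the very next dart, and
  the walk is back at \<open>u\<close>. It would then have to end at \<open>u\<close> or leave
  \<open>u\<close> a second time, and both are excluded.\<close>

lemma simple_walk_distinct_edges:
  assumes "walk G u ds v" "distinct (map (org G) ds)" "v \<notin> org G ` set ds"
  shows "distinct (map (underlying_edge G) ds)"
  using assms
proof (induction ds arbitrary: u)
  case (Cons d ds)
  have "underlying_edge G d \<noteq> underlying_edge G e" if e: "e \<in> set ds" for e
  proof
    assume "underlying_edge G d = underlying_edge G e"
    moreover have "e \<noteq> d" using Cons.prems(2) e by auto
    ultimately have e_flip: "e = flip G d" using underlying_edge_eqD by blast
    then have head_e: "head G e = u"
      using Cons.prems(1) by (simp add: flip_flip)
    obtain x xs where ds: "ds = x # xs" using e by (cases ds) auto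
    have "org G x = org G e" using Cons.prems(1) ds e_flip by simp
    then have "x = e" using Cons.prems(2) e ds by (auto simp: image_iff)
    then have "walk G u xs v" using Cons.prems(1) ds head_e by simp
    then show False
      using Cons.prems ds walk_start[of G u xs v] by (cases "xs = []") auto
  qed
  then show ?case using Cons by auto
qed simp

lemma mem_Union_edges:
  assumes "T \<subseteq> edges G"
  shows "d \<in> \<Union>T \<longleftrightarrow> d \<in> darts G \<and> underlying_edge G d \<in> T"
proof
  assume "d \<in> \<Union>T"
  then obtain E where E: "E \<in> T" "d \<in> E" by auto
  then obtain e where e: "e \<in> darts G" "E = underlying_edge G e"
    using assms by (auto simp: edges_def)
  then have "d = e \<or> d = flip G e" using E by (auto simp: underlying_edge_def)
  then show "d \<in> darts G \<and> underlying_edge G d \<in> T"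
    using E e underlying_edge_flip flip_in_darts by auto
qed (auto simp: underlying_edge_def)

lemma multigraph_restrict_edges:
  assumes "T \<subseteq> edges G"
  shows "multigraph (restrict_edges G T)"
proof -
  have "d \<in> \<Union>T \<Longrightarrow> d \<in> darts G" for d
    using mem_Union_edges[OF assms] by blast
  moreover have "d \<in> \<Union>T \<Longrightarrow> flip G d \<in> \<Union>T" for d
    using mem_Union_edges[OF assms] underlying_edge_flip flip_in_darts by simp
  ultimately show ?thesis
    by unfold_locales (auto simp: org_in_verts flip_flip flip_neq)
qed

end

context finite_multigraph
begin

lemma finite_multigraph_restrict_edges:
  assumes "T \<subseteq> edges G"
  shows "finite_multigraph (restrict_edges G T)"
proof -
  have "\<Union>T \<subseteq> darts G" using mem_Union_edges[OF assms] by blast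
  then show ?thesis
    using multigraph_restrict_edges[OF assms] finite_verts finite_darts
    by (auto simp: finite_multigraph_def finite_multigraph_axioms_def finite_subset)
qed

section \<open>Forests with one root correspond to spanning trees\<close>

lemma finite_rooted_forests: "finite (rooted_forests G)"
  using finite_dart_choices by (simp add: rooted_forests_def)

text \<open>The rank of a vertex is its number of proper ancestors. A numerical rank has a maximum
  on a cycle, where well-foundedness by itself provides minima.\<close>

lemma forest_rank:
  assumes "f \<in> rooted_forests G"
  shows "\<exists>\<delta> :: 'a \<Rightarrow> nat. \<forall>v\<in>verts G. \<forall>d. f v = Some d \<longrightarrow> \<delta> (head G d) < \<delta> v"
proof -
  let ?R = "parent_rel G f"
  have fin: "finite (?R\<^sup>+)" and wf: "wf ?R"
    using assms finite_parent_rel by (auto simp: rooted_forests_def)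
  have acyc: "(u, u) \<notin> ?R\<^sup>+" for u
    using wf wf_acyclic acyclic_def by metis
  have "card {u. (u, head G d) \<in> ?R\<^sup>+} < card {u. (u, v) \<in> ?R\<^sup>+}"
    if "v \<in> verts G" "f v = Some d" for v d
  proof (rule psubset_card_mono)
    have "{u. (u, v) \<in> ?R\<^sup>+} \<subseteq> fst ` (?R\<^sup>+)" by force
    then show "finite {u. (u, v) \<in> ?R\<^sup>+}" using fin finite_subset by blast
    have "(head G d, v) \<in> ?R" using that by (auto simp: parent_rel_def)
    then show "{u. (u, head G d) \<in> ?R\<^sup>+} \<subset> {u. (u, v) \<in> ?R\<^sup>+}"
      using acyc[of "head G d"] by (auto intro: trancl_into_trancl)
  qed
  then show ?thesis
    by (intro exI[of _ "\<lambda>v. card {u. (u, v) \<in> ?R\<^sup>+}"] ballI allI impI)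
qed

lemma forest_edges_subset:
  assumes "f \<in> dart_choices G"
  shows "forest_edges G f \<subseteq> edges G"
  using dart_choicesD[OF assms] by (auto simp: forest_edges_def edges_def)

lemma dart_in_forest:
  assumes f: "f \<in> dart_choices G" and d: "d \<in> \<Union>(forest_edges G f)"
  shows "f (org G d) = Some d \<or> f (head G d) = Some (flip G d)"
proof -
  obtain e v where e: "v \<in> verts G" "f v = Some e" "d = e \<or> d = flip G e"
    using d by (auto simp: forest_edges_def underlying_edge_def)
  then show ?thesis
    using dart_choicesD[OF f e(1,2)] by (auto simp: flip_flip)
qed

lemma forest_dart_mem:
  "v \<in> verts G \<Longrightarrow> f v = Some d \<Longrightarrow> d \<in> \<Union>(forest_edges G f)"
  by (auto simp: forest_edges_def underlying_edge_def)

lemma walk_to_root: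
  assumes f: "f \<in> rooted_forests G" and r: "roots G f = {r}" and v: "v \<in> verts G"
  shows "\<exists>ds. walk (restrict_edges G (forest_edges G f)) v ds r"
proof -
  let ?T = "restrict_edges G (forest_edges G f)"
  have fc: "f \<in> dart_choices G" using f by (simp add: rooted_forests_def)
  obtain \<delta> :: "'a \<Rightarrow> nat"
    where "\<forall>v\<in>verts G. \<forall>d. f v = Some d \<longrightarrow> \<delta> (head G d) < \<delta> v"
    using forest_rank[OF f] by blast
  note \<delta> = this[rule_format]
  show ?thesis
    using v
  proof (induction "\<delta> v" arbitrary: v rule: less_induct)
    case less
    show ?case
    proof (cases "f v")
      case None
      then have "v = r" using less.prems r by (auto simp: roots_def)
      then have "walk ?T v [] r" using less.prems by simp
      then show ?thesis by blast
    next
      case (Some d)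
      note d = dart_choicesD[OF fc less.prems Some]
      obtain ds where "walk ?T (head G d) ds r"
        using less.hyps[OF \<delta>[OF less.prems Some] head_in_verts[OF d(1)]] by blast
      then have "walk ?T v (d # ds) r"
        using d(2) forest_dart_mem[of v f d] less.prems Some by simp
      then show ?thesis by blast
    qed
  qed
qed

lemma connected_forest:
  assumes f: "f \<in> rooted_forests G" and r: "roots G f = {r}"
  shows "connected_graph (restrict_edges G (forest_edges G f))"
proof -
  let ?T = "restrict_edges G (forest_edges G f)"
  have fc: "f \<in> dart_choices G" using f by (simp add: rooted_forests_def)
  interpret T: multigraph ?T
    by (rule multigraph_restrict_edges[OF forest_edges_subset[OF fc]])
  have "\<exists>ds. walk ?T u ds v" if "u \<in> verts G" "v \<in> verts G" for u v
    using walk_to_root[OF f r that(1)] walk_to_root[OF f r that(2)] T.walk_rev walk_append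
    by metis
  moreover have "r \<in> verts G" using r by (auto simp: roots_def)
  ultimately show ?thesis
    by (auto simp: connected_graph_def)
qed

text \<open>
  At a vertex of maximal rank on a cycle, both adjacent edges of the cycle would have to be the
  edge towards the parent.
\<close>

lemma forest_acyclic:
  assumes f: "f \<in> rooted_forests G"
  shows "\<not> cycle (restrict_edges G (forest_edges G f)) ds"
proof
  let ?T = "restrict_edges G (forest_edges G f)"
  assume cyc: "cycle ?T ds"
  then obtain u where ds: "ds \<noteq> []" and w: "walk ?T u ds u"
    and dist: "distinct (map (underlying_edge G) ds)"
    by (auto simp: cycle_def)
  have fc: "f \<in> dart_choices G" using f by (simp add: rooted_forests_def)
  obtain \<delta> :: "'a \<Rightarrow> nat"
    where "\<forall>v\<in>verts G. \<forall>d. f v = Some d \<longrightarrow> \<delta> (head G d) < \<delta> v"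
    using forest_rank[OF f] by blast
  note \<delta> = this[rule_format]
  have T: "d \<in> \<Union>(forest_edges G f)" if "d \<in> set ds" for d
    using walk_darts[OF w that] by simp
  have D: "d \<in> darts G" if "d \<in> set ds" for d
    using T[OF that] mem_Union_edges[OF forest_edges_subset[OF fc]] by blast
  obtain d where d: "d \<in> set ds" and max: "\<And>e. e \<in> set ds \<Longrightarrow> \<delta> (org G e) \<le> \<delta> (org G d)"
  proof -
    have fin: "finite ((\<lambda>d. \<delta> (org G d)) ` set ds)" "(\<lambda>d. \<delta> (org G d)) ` set ds \<noteq> {}"
      using ds by auto
    then obtain d where "d \<in> set ds" "\<delta> (org G d) = Max ((\<lambda>d. \<delta> (org G d)) ` set ds)"
      using Max_in by (metis (mono_tags, lifting) imageE)
    then show ?thesis using that fin by auto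
  qed
  have head_max: "\<delta> (head G e) \<le> \<delta> (org G d)" if "e \<in> set ds" for e
    using walk_successor[OF w that] walk_start[OF w ds] max by fastforce
  obtain e where e: "e \<in> set ds" "head G e = org G d"
    using walk_predecessor[OF w d] walk_end[OF w ds] by fastforce
  \<comment> \<open>An edge of the forest is chosen at one of its ends, and the rank is larger at
    that end. As \<open>org G d\<close> has maximal rank on the cycle, that end is
    \<open>org G d\<close>.\<close>
  have "f (org G d) = Some d"
    using dart_in_forest[OF fc T[OF d]] \<delta>[of "head G d" "flip G d"] head_max[OF d] D[OF d]
    by (auto simp: flip_flip head_in_verts)
  moreover have "f (head G e) = Some (flip G e)"
    using dart_in_forest[OF fc T[OF e(1)]] \<delta>[of "org G e" e] max[OF e(1)] D[OF e(1)] e(2)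
    by (auto simp: org_in_verts)
  ultimately have de: "d = flip G e" using e by simp
  then have "underlying_edge G d = underlying_edge G e"
    using underlying_edge_flip D e by simp
  then have "d = e" using dist d e by (auto simp: distinct_map dest: inj_onD)
  then show False using de flip_neq D e by metis
qed

lemma forest_edges_spanning_tree:
  assumes "f \<in> rooted_forests G" "roots G f = {r}"
  shows "forest_edges G f \<in> spanning_trees G"
  using connected_forest[OF assms] forest_acyclic[OF assms(1)] forest_edges_subset assms(1)
  by (auto simp: spanning_trees_def tree_graph_def rooted_forests_def)

text \<open>Induction away from the root. If \<open>f\<close> and \<open>g\<close> agree at the
  parent of \<open>v\<close>, then \<open>g\<close> cannot choose the joining edge at the parent:
  \<open>f\<close> would do so too, and the rank would drop in both directions. Hence
  \<open>g\<close> chooses it at \<open>v\<close>.\<close>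

lemma forest_edges_inj:
  assumes f: "f \<in> rooted_forests G" "roots G f = {r}"
    and g: "g \<in> rooted_forests G" "roots G g = {r}"
    and eq: "forest_edges G f = forest_edges G g"
  shows "f = g"
proof -
  have fc: "f \<in> dart_choices G" and gc: "g \<in> dart_choices G"
    using f g by (auto simp: rooted_forests_def)
  obtain \<delta> :: "'a \<Rightarrow> nat"
    where "\<forall>v\<in>verts G. \<forall>d. f v = Some d \<longrightarrow> \<delta> (head G d) < \<delta> v"
    using forest_rank[OF f(1)] by blast
  note \<delta> = this[rule_format]
  have "f v = g v" if "v \<in> verts G" for v
    using that
  proof (induction "\<delta> v" arbitrary: v rule: less_induct)
    case less
    show ?case
    proof (cases "f v")
      case None
      then have "v \<in> roots G g" using less.prems f g by (auto simp: roots_def)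
      then show ?thesis using None by (simp add: roots_def)
    next
      case (Some d)
      note d = dart_choicesD[OF fc less.prems Some]
      note lt = \<delta>[OF less.prems Some]
      have "g (head G d) \<noteq> Some (flip G d)"
      proof
        assume "g (head G d) = Some (flip G d)"
        then have "f (head G d) = Some (flip G d)"
          using less.hyps[OF lt head_in_verts[OF d(1)]] by simp
        from \<delta>[OF head_in_verts[OF d(1)] this] show False
          using lt d by (simp add: flip_flip)
      qed
      then have "g v = Some d"
        using dart_in_forest[OF gc, of d] forest_dart_mem[of v f d, OF less.prems Some] eq d by auto
      then show ?thesis using Some by simp
    qed
  qed
  then show ?thesis
    using fc gc unfolding dart_choices_def by (intro PiE_ext) auto
qed

text \<open>\<open>\<delta>\<close> is the distance to \<open>r\<close>. The first dart of a
  shortest walk leads nearer to \<open>r\<close>; choosing any dart with that property makes the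
  distance a measure for the parent relation.\<close>

lemma connected_has_forest:
  assumes conn: "connected_graph G" and r: "r \<in> verts G"
  obtains f where "f \<in> rooted_forests G" "roots G f = {r}"
proof -
  define \<delta> where "\<delta> v = (LEAST n. \<exists>ds. walk G v ds r \<and> length ds = n)" for v
  have ex: "\<exists>d. d \<in> out_darts G v \<and> \<delta> (head G d) < \<delta> v" if v: "v \<in> verts G" "v \<noteq> r" for v
  proof -
    have "\<exists>n ds. walk G v ds r \<and> length ds = n"
      using conn v r by (auto simp: connected_graph_def)
    then have "\<exists>ds. walk G v ds r \<and> length ds = \<delta> v"
      unfolding \<delta>_def by (rule LeastI_ex)
    then obtain ds where ds: "walk G v ds r" "length ds = \<delta> v" by blast
    then obtain d es where "ds = d # es" using v by (cases ds) auto
    with ds have d: "d \<in> out_darts G v" "walk G (head G d) es r" "length es < \<delta> v"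
      by (auto simp: out_darts_def)
    then have "\<delta> (head G d) \<le> length es"
      unfolding \<delta>_def by (intro Least_le) blast
    then show ?thesis using d by auto
  qed
  define f where "f = (\<lambda>v\<in>verts G. if v = r then None
    else Some (SOME d. d \<in> out_darts G v \<and> \<delta> (head G d) < \<delta> v))"
  have f: "d \<in> out_darts G v \<and> \<delta> (head G d) < \<delta> v" if "v \<in> verts G" "f v = Some d" for v d
    using someI_ex[OF ex] that by (auto simp: f_def split: if_splits)
  have "f \<in> dart_choices G"
    unfolding dart_choices_def
  proof (rule PiE_I)
    fix v assume "v \<in> verts G"
    then show "f v \<in> insert None (Some ` out_darts G v)"
      using f[of v] by (cases "f v") auto
  qed (simp add: f_def)
  moreover have "wf (parent_rel G f)"
    by (rule wf_subset[OF wf_measure[of \<delta>]]) (use f in \<open>auto simp: parent_rel_def\<close>)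
  moreover have "roots G f = {r}"
    using r by (auto simp: roots_def f_def split: if_splits)
  ultimately show ?thesis
    using that by (auto simp: rooted_forests_def)
qed

text \<open>Connectedness yields a forest with root \<open>r\<close> inside \<open>T\<close>. A
  further edge of \<open>T\<close>, followed by a simple walk of the forest joining its ends, would
  be a cycle; for a loop that walk is empty.\<close>

lemma spanning_tree_is_forest:
  assumes T: "T \<in> spanning_trees G" and r: "r \<in> verts G"
  obtains f where "f \<in> rooted_forests G" "roots G f = {r}" "forest_edges G f = T"
proof -
  let ?T = "restrict_edges G T"
  have sub: "T \<subseteq> edges G" and tree: "connected_graph ?T" "\<nexists>ds. cycle ?T ds"
    using T by (auto simp: spanning_trees_def tree_graph_def)
  interpret T: finite_multigraph ?T by (rule finite_multigraph_restrict_edges[OF sub])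
  obtain f where f: "f \<in> rooted_forests ?T" "roots ?T f = {r}"
    using T.connected_has_forest tree(1) r by auto
  have UT: "\<Union>T \<subseteq> darts G" using mem_Union_edges[OF sub] by blast
  have "f \<in> dart_choices ?T" using f by (simp add: rooted_forests_def)
  have "dart_choices ?T \<subseteq> dart_choices G"
  proof -
    have "verts ?T = verts G" by simp
    then show ?thesis
      unfolding dart_choices_def using UT by (auto intro!: PiE_mono simp: out_darts_def)
  qed
  then have f': "f \<in> rooted_forests G" "roots G f = {r}"
    using f by (auto simp: rooted_forests_def parent_rel_def roots_def)
  have fsub: "forest_edges G f \<subseteq> T"
  proof -
    have "d \<in> \<Union>T" if "v \<in> verts G" "f v = Some d" for v d
      using dart_choicesD[OF \<open>f \<in> dart_choices ?T\<close>, of v d] that by simp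
    then show ?thesis
      using mem_Union_edges[OF sub] by (auto simp: forest_edges_def)
  qed
  moreover have "E \<in> forest_edges G f" if E: "E \<in> T" for E
  proof (rule ccontr)
    assume nE: "E \<notin> forest_edges G f"
    let ?F = "restrict_edges G (forest_edges G f)"
    obtain d where d: "d \<in> darts G" "E = underlying_edge G d"
      using sub E by (auto simp: edges_def)
    have dT: "d \<in> \<Union>T" using d E mem_Union_edges[OF sub] by blast
    have Fsub: "forest_edges G f \<subseteq> edges G" using fsub sub by blast
    interpret F: finite_multigraph ?F by (rule finite_multigraph_restrict_edges[OF Fsub])
    have "head G d \<in> verts ?F" "org G d \<in> verts ?F"
      using d head_in_verts org_in_verts by auto
    then obtain ds where "walk ?F (head G d) ds (org G d)"
      using connected_forest[OF f'] unfolding connected_graph_def by blast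
    from walk_simple[OF this] obtain es where es: "walk ?F (head G d) es (org G d)"
        "distinct (map (org G) es)" "org G d \<notin> org G ` set es"
      by auto
    have "distinct (map (underlying_edge G) es)"
      using F.simple_walk_distinct_edges[OF es(1)] es by simp
    moreover have "underlying_edge G d \<notin> underlying_edge G ` set es"
    proof -
      have "underlying_edge G e \<in> forest_edges G f" if "e \<in> set es" for e
        using walk_darts[OF es(1) that] mem_Union_edges[OF Fsub] by simp
      then show ?thesis using nE d by auto
    qed
    moreover have "walk ?T (org G d) (d # es) (org G d)"
      using walk_mono[OF es(1) Union_mono[OF fsub]] dT by simp
    ultimately have "cycle ?T (d # es)"
      using es by (auto simp: cycle_def)
    then show False using tree by blast
  qed
  ultimately show ?thesis
    using that f' by blast
qed

lemma card_forests_with_root: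
  assumes "r \<in> verts G"
  shows "card {f \<in> rooted_forests G. roots G f = {r}} = kappa G"
  unfolding kappa_def
proof (rule bij_betw_same_card[of "forest_edges G"], rule bij_betw_imageI)
  show "inj_on (forest_edges G) {f \<in> rooted_forests G. roots G f = {r}}"
    by (auto intro!: inj_onI forest_edges_inj)
  show "forest_edges G ` {f \<in> rooted_forests G. roots G f = {r}} = spanning_trees G"
    using forest_edges_spanning_tree spanning_tree_is_forest[OF _ assms] by blast
qed

section \<open>The linear coefficient of the shifted determinant\<close>

lemma card_rooted_trees:
  "card {f \<in> rooted_forests G. card (roots G f) = 1} = card (verts G) * kappa G"
proof -
  have "{f \<in> rooted_forests G. card (roots G f) = 1} =
      (\<Union>r\<in>verts G. {f \<in> rooted_forests G. roots G f = {r}})"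
    by (auto simp: card_1_singleton_iff roots_def)
  also have "card \<dots> = (\<Sum>r\<in>verts G. card {f \<in> rooted_forests G. roots G f = {r}})"
    by (rule card_UN_disjoint) (auto simp: finite_verts finite_rooted_forests)
  finally show ?thesis
    using card_forests_with_root by simp
qed

lemma kappa_pos:
  assumes "connected_graph G"
  shows "kappa G > 0"
proof -
  obtain r where r: "r \<in> verts G" using assms by (auto simp: connected_graph_def)
  obtain f where "f \<in> rooted_forests G" "roots G f = {r}"
    using connected_has_forest[OF assms r] .
  then have "{f \<in> rooted_forests G. roots G f = {r}} \<noteq> {}" by blast
  then have "card {f \<in> rooted_forests G. roots G f = {r}} > 0"
    using finite_rooted_forests by (simp add: card_gt_0_iff)
  then show ?thesis using card_forests_with_root[OF r] by simp
qed

text \<open>A vertex minimal for the parent relation can have chosen no dart. This makes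
  \<open>card (roots G f) - 1\<close> a true subtraction when a factor \<open>t\<close> is split
  off.\<close>

lemma card_roots_pos:
  assumes f: "f \<in> rooted_forests G" and "verts G \<noteq> {}"
  shows "card (roots G f) > 0"
proof -
  have fc: "f \<in> dart_choices G" using f by (simp add: rooted_forests_def)
  obtain w where w: "w \<in> verts G" using assms by blast
  have "wf (parent_rel G f)" using f by (simp add: rooted_forests_def)
  from wfE_min[OF this w] obtain v where v: "v \<in> verts G" "\<And>u. (u, v) \<in> parent_rel G f \<Longrightarrow> u \<notin> verts G"
    by auto
  have "f v = None"
  proof (rule ccontr)
    assume "f v \<noteq> None"
    then obtain d where d: "f v = Some d" by auto
    then have "(head G d, v) \<in> parent_rel G f" using v(1) by (auto simp: parent_rel_def)
    from v(2)[OF this] show False using head_in_verts dart_choicesD(1)[OF fc v(1) d] by simp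
  qed
  then have "roots G f \<noteq> {}" using v(1) by (auto simp: roots_def)
  then show ?thesis using finite_verts by (simp add: roots_def card_gt_0_iff)
qed

text \<open>At 0 the remaining power is 1 for the forests with one root, by the convention 0^0 = 1,
  and 0 for all others. Continuity is recorded because an identity between such \<open>Q\<close> is
  first obtained away from 0.\<close>

lemma set_det_shifted_laplacian_factor:
  assumes "verts G \<noteq> {}"
  shows "\<exists>Q :: real \<Rightarrow> real. (\<forall>t. set_det (verts G) (shifted_laplacian G t) = t * Q t) \<and>
    isCont Q 0 \<and> Q 0 = real (card (verts G) * kappa G)"
proof (intro exI conjI allI)
  let ?Q = "\<lambda>t::real. \<Sum>f\<in>rooted_forests G. t ^ (card (roots G f) - 1)"
  show "set_det (verts G) (shifted_laplacian G t) = t * ?Q t" for t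
    unfolding set_det_shifted_laplacian sum_distrib_left
  proof (rule sum.cong[OF refl])
    fix f assume "f \<in> rooted_forests G"
    then have "card (roots G f) > 0" using card_roots_pos assms by blast
    then show "t ^ card (roots G f) = t * t ^ (card (roots G f) - 1)"
      by (cases "card (roots G f)") simp_all
  qed
  show "isCont ?Q 0" by (intro continuous_intros)
  have "?Q 0 = (\<Sum>f\<in>{f \<in> rooted_forests G. card (roots G f) = 1}. 1)"
  proof (rule sum.mono_neutral_cong_right)
    show "\<forall>f\<in>rooted_forests G - {f \<in> rooted_forests G. card (roots G f) = 1}.
        (0::real) ^ (card (roots G f) - 1) = 0"
    proof
      fix f assume "f \<in> rooted_forests G - {f \<in> rooted_forests G. card (roots G f) = 1}"
      then have "card (roots G f) - 1 > 0"
        using card_roots_pos[of f] assms by auto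
      then show "(0::real) ^ (card (roots G f) - 1) = 0" by simp
    qed
  qed (auto simp: finite_rooted_forests)
  then show "?Q 0 = real (card (verts G) * kappa G)"
    using card_rooted_trees by simp
qed

end

section \<open>Covers as local bijections on darts\<close>

definition combinatorial_cover ::
    "('w, 'c) mgraph \<Rightarrow> ('v, 'd) mgraph \<Rightarrow> ('w, 'c, 'v, 'd) mgraph_map \<Rightarrow> bool"
  where "combinatorial_cover Y X p \<longleftrightarrow> morphism Y X p \<and> fst p ` verts Y = verts X \<and>
    (\<forall>w\<in>verts Y. bij_betw (snd p) (out_darts Y w) (out_darts X (fst p w)))"

text \<open>The bound 1/4 is below 1/2, so that every point of the star other than its centre
  determines its dart.\<close>

definition open_star :: "('v, 'd) mgraph \<Rightarrow> 'v \<Rightarrow> ('v, 'd) point set"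
  where "open_star G v = insert (Vertex v)
    {dart_point G d t | d t. d \<in> out_darts G v \<and> 0 < t \<and> t < 1/4}"

lemma dart_point_Inner:
  "0 < t \<Longrightarrow> t < 1 \<Longrightarrow> dart_point G d t = Inner {(d, t), (flip G d, 1 - t)}"
  by (simp add: dart_point_def)

text \<open>An inner point is shared by a dart and its flip, with parameters adding up to 1; the
  bound 1/2 selects one of them.\<close>

lemma dart_point_eqD:
  assumes "dart_point G d s = dart_point H e t" "0 < s" "s < 1/2" "0 < t" "t < 1/2"
  shows "d = e" "s = t"
  using assms by (auto simp: dart_point_Inner doubleton_eq_iff)

text \<open>In the weak topology the preimage of \<open>V\<close> under the characteristic map of
  \<open>d\<close> is relatively open in the unit interval, and here it contains 0.\<close>

lemma dart_point_near_vertex: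
  assumes "openin (realization G) V" "Vertex v \<in> V" "d \<in> out_darts G v"
  shows "\<exists>e>0. \<forall>t. 0 < t \<and> t < e \<longrightarrow> dart_point G d t \<in> V"
proof -
  let ?A = "{t \<in> {0..1}. dart_point G d t \<in> V}"
  have "openin (top_of_set {0..1}) ?A" "0 \<in> ?A"
    using assms by (auto simp: openin_realization out_darts_def dart_point_def)
  then have "\<exists>e>0. ball 0 e \<inter> {0..1} \<subseteq> ?A"
    unfolding openin_contains_ball by blast
  then obtain e where e: "e > 0" "ball 0 e \<inter> {0..1} \<subseteq> ?A"
    by blast
  have "dart_point G d t \<in> V" if "0 < t" "t < min e 1" for t
  proof -
    have "t \<in> ball 0 e \<inter> {0..1}" using that by simp
    then show ?thesis using e(2) by blast
  qed
  then show ?thesis using e(1) by (intro exI[of _ "min e 1"]) simp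
qed

context multigraph
begin

lemma dart_point_flip:
  "d \<in> darts G \<Longrightarrow> 0 < t \<Longrightarrow> t < 1 \<Longrightarrow> dart_point G (flip G d) (1 - t) = dart_point G d t"
  by (simp add: dart_point_Inner flip_flip insert_commute)

lemma Vertex_in_points_iff: "Vertex v \<in> points G \<longleftrightarrow> v \<in> verts G"
  by (auto simp: points_def dart_point_def org_in_verts flip_in_darts split: if_splits)

lemma openin_open_star:
  assumes v: "v \<in> verts G"
  shows "openin (realization G) (open_star G v)"
  unfolding openin_realization
proof (intro conjI ballI)
  have "dart_point G d t \<in> points G" if "d \<in> out_darts G v" "0 < t" "t < 1/4" for d t
    using that by (force simp: points_def out_darts_def)
  then show "open_star G v \<subseteq> points G"
    using v by (auto simp: open_star_def Vertex_in_points_iff)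
next
  fix d assume d: "d \<in> darts G"
  \<comment> \<open>An initial part of \<open>d\<close> lies in the star if \<open>d\<close> leaves
    \<open>v\<close>, a final part if \<open>d\<close> enters \<open>v\<close>; for a loop at
    \<open>v\<close> both occur.\<close>
  let ?U = "(if org G d = v then {..<1/4} else {}) \<union> (if head G d = v then {3/4<..} else {}) :: real set"
  have "dart_point G d t \<in> open_star G v \<longleftrightarrow> t \<in> ?U" if t: "t \<in> {0..1}" for t
  proof -
    consider "t = 0" | "t = 1" | "0 < t" "t < 1" using t by fastforce
    then show ?thesis
    proof cases
      case 1
      then show ?thesis by (auto simp: open_star_def dart_point_def)
    next
      case 2
      then show ?thesis by (auto simp: open_star_def dart_point_def)
    next
      case 3
      have "dart_point G d t \<in> open_star G v \<longleftrightarrow>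
          (\<exists>e s. e \<in> out_darts G v \<and> 0 < s \<and> s < 1/4 \<and> dart_point G d t = dart_point G e s)"
        using 3 by (auto simp: open_star_def dart_point_Inner)
      also have "\<dots> \<longleftrightarrow> t \<in> ?U"
      proof
        assume "\<exists>e s. e \<in> out_darts G v \<and> 0 < s \<and> s < 1/4 \<and> dart_point G d t = dart_point G e s"
        then obtain e s where e: "e \<in> out_darts G v" "0 < s" "s < 1/4"
          "dart_point G d t = dart_point G e s" by blast
        then have "(d, t) = (e, s) \<or> (flip G d, 1 - t) = (e, s)"
          using 3 by (auto simp: dart_point_Inner doubleton_eq_iff)
        then show "t \<in> ?U"
          using e by (auto simp: out_darts_def)
      next
        assume "t \<in> ?U"
        then consider "org G d = v" "t < 1/4" | "head G d = v" "t > 3/4"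
          by (auto split: if_splits)
        then show "\<exists>e s. e \<in> out_darts G v \<and> 0 < s \<and> s < 1/4 \<and> dart_point G d t = dart_point G e s"
        proof cases
          case 1
          then show ?thesis using 3 d by (auto simp: out_darts_def)
        next
          case 2
          then show ?thesis
            using 3 d dart_point_flip[OF d, of t]
            by (intro exI[of _ "flip G d"] exI[of _ "1 - t"]) (auto simp: out_darts_def flip_in_darts)
        qed
      qed
      finally show ?thesis .
    qed
  qed
  then have "{t \<in> {0..1}. dart_point G d t \<in> open_star G v} = {0..1} \<inter> ?U" by blast
  moreover have "open ?U" by (intro open_Un) auto
  ultimately show "openin (top_of_set {0..1}) {t \<in> {0..1}. dart_point G d t \<in> open_star G v}"
    by (simp only: openin_open_Int)
qed

end

text \<open>Everything is read off from the sheet \<open>V\<close> through \<open>Vertex w\<close>.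
  Two darts at \<open>w\<close> with the same image have initial points in \<open>V\<close> with
  equal images, and injectivity on \<open>V\<close> identifies them. Conversely, the image of a
  neighbourhood of \<open>w\<close> is open, so it contains initial points of each dart leaving the
  image of \<open>w\<close>.\<close>

lemma graph_cover_imp_combinatorial:
  assumes "multigraph Y" and "multigraph X" and cover: "graph_cover Y X p"
  shows "combinatorial_cover Y X p"
proof -
  interpret Y: multigraph Y by fact
  interpret X: multigraph X by fact
  let ?p = "realization_map p" and ?RY = "realization Y" and ?RX = "realization X"
  have mor: "morphism Y X p" and cov: "covering_map ?RY ?RX ?p"
    using cover by (auto simp: graph_cover_def)
  note pt = realization_map_dart_point[OF \<open>multigraph Y\<close> mor]
  have "fst p ` verts Y = verts X"
  proof
    show "fst p ` verts Y \<subseteq> verts X" using mor by (auto simp: morphism_def)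
    show "verts X \<subseteq> fst p ` verts Y"
    proof
      fix v assume "v \<in> verts X"
      then have "Vertex v \<in> ?p ` points Y"
        using cov by (simp add: covering_map_def topspace_realization X.Vertex_in_points_iff)
      then obtain y where y: "y \<in> points Y" "?p y = Vertex v" by auto
      then obtain w where "y = Vertex w" by (cases y) auto
      then show "v \<in> fst p ` verts Y" using y by (auto simp: Y.Vertex_in_points_iff)
    qed
  qed
  moreover have "bij_betw (snd p) (out_darts Y w) (out_darts X (fst p w))" if w: "w \<in> verts Y" for w
  proof -
    have "Vertex (fst p w) \<in> topspace ?RX"
      using w mor by (simp add: topspace_realization X.Vertex_in_points_iff morphism_def)
    then obtain U \<V> where U: "Vertex (fst p w) \<in> U" "openin ?RX U"
      and \<V>: "\<Union>\<V> = {y \<in> topspace ?RY. ?p y \<in> U}" "\<forall>V\<in>\<V>. openin ?RY V"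
        "\<forall>V\<in>\<V>. homeomorphic_map (subtopology ?RY V) (subtopology ?RX U) ?p"
      using cov unfolding covering_map_def by blast
    have "Vertex w \<in> \<Union>\<V>"
      unfolding \<V>(1) using w U by (simp add: topspace_realization Y.Vertex_in_points_iff)
    then obtain V where V: "Vertex w \<in> V" "openin ?RY V"
      and hom: "homeomorphic_map (subtopology ?RY V) (subtopology ?RX U) ?p"
      using \<V> by blast
    have top_V: "topspace (subtopology ?RY V) = V"
      using openin_subset[OF V(2)] by auto
    show ?thesis
    proof (rule bij_betw_imageI)
      show "inj_on (snd p) (out_darts Y w)"
      proof (rule inj_onI)
        fix d e assume d: "d \<in> out_darts Y w" and e: "e \<in> out_darts Y w" and eq: "snd p d = snd p e"
        obtain a where a: "a > 0" "\<forall>t. 0 < t \<and> t < a \<longrightarrow> dart_point Y d t \<in> V"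
          using dart_point_near_vertex[OF V(2,1) d] by blast
        obtain b where b: "b > 0" "\<forall>t. 0 < t \<and> t < b \<longrightarrow> dart_point Y e t \<in> V"
          using dart_point_near_vertex[OF V(2,1) e] by blast
        define t where "t = min (min a b) (1/2) / 2"
        have t: "0 < t" "t < a" "t < b" "t < 1/2" using a b by (auto simp: t_def)
        have "?p (dart_point Y d t) = ?p (dart_point Y e t)"
          using d e eq by (simp add: pt out_darts_def)
        then have "dart_point Y d t = dart_point Y e t"
          using homeomorphic_imp_injective_map[OF hom] a(2) b(2) t
          unfolding top_V by (auto dest: inj_onD)
        then show "d = e" using t dart_point_eqD(1) by metis
      qed
    next
      show "snd p ` out_darts Y w = out_darts X (fst p w)"
      proof
        show "snd p ` out_darts Y w \<subseteq> out_darts X (fst p w)"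
          using mor by (auto simp: out_darts_def morphism_def)
        show "out_darts X (fst p w) \<subseteq> snd p ` out_darts Y w"
        proof
          fix e assume e: "e \<in> out_darts X (fst p w)"
          \<comment> \<open>The star forces the preimages onto darts leaving \<open>w\<close>; in
            \<open>V\<close> alone they might lie on other edges.\<close>
          let ?W = "V \<inter> open_star Y w"
          have "openin ?RY ?W" using V(2) Y.openin_open_star[OF w] by (rule openin_Int)
          then have "openin (subtopology ?RY V) ?W"
            using V(2) by (simp add: openin_open_subtopology)
          then have "openin (subtopology ?RX U) (?p ` ?W)"
            using homeomorphic_imp_open_map[OF hom] by (simp add: open_map_def)
          then have "openin ?RX (?p ` ?W)"
            using U(2) by (simp add: openin_open_subtopology)
          moreover have "Vertex (fst p w) \<in> ?p ` ?W"
            using V(1) by (auto simp: open_star_def intro!: image_eqI[of _ _ "Vertex w"])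
          ultimately obtain a where a: "a > 0"
              "\<forall>t. 0 < t \<and> t < a \<longrightarrow> dart_point X e t \<in> ?p ` ?W"
            using dart_point_near_vertex[OF _ _ e] by blast
          define t where "t = min a (1/2) / 2"
          have t: "0 < t" "t < a" "t < 1/2" using a by (auto simp: t_def)
          then obtain y where y: "y \<in> open_star Y w" "?p y = dart_point X e t"
            using a(2) by auto
          have "y \<noteq> Vertex w" using y t by (auto simp: dart_point_Inner)
          then obtain d s where d: "d \<in> out_darts Y w" "0 < s" "s < 1/4" "y = dart_point Y d s"
            using y by (auto simp: open_star_def)
          then have "dart_point X (snd p d) s = dart_point X e t"
            using y by (simp add: pt out_darts_def)
          then have "snd p d = e" using t d dart_point_eqD(1) by fastforce
          then show "e \<in> snd p ` out_darts Y w" using d by blast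
        qed
      qed
    qed
  qed
  ultimately show ?thesis
    using mor by (simp add: combinatorial_cover_def)
qed

lemma sum_of_bool_eq:
  "finite F \<Longrightarrow> (\<Sum>v\<in>F. of_bool (x = v)) = (of_bool (x \<in> F) :: 'r::comm_ring_1)"
  by (simp add: of_bool_def)

text \<open>The darts leaving \<open>u\<close> correspond to those leaving its image, with heads
  over heads. Summing row \<open>u\<close> over the fibre of \<open>x\<close> collects exactly the
  darts below that end at \<open>x\<close>, and the diagonal terms likewise.\<close>

lemma shifted_laplacian_cover:
  assumes "finite_multigraph Y" and cover: "combinatorial_cover Y X p" and u: "u \<in> verts Y"
  shows "shifted_laplacian X t (fst p u) x =
    (\<Sum>v | v \<in> verts Y \<and> fst p v = x. shifted_laplacian Y t u v)"
proof -
  interpret Y: finite_multigraph Y by fact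
  let ?F = "{v \<in> verts Y. fst p v = x}"
  have F: "finite ?F" using Y.finite_verts by simp
  have head: "head X (snd p d) = fst p (head Y d) \<and> head Y d \<in> verts Y"
    if "d \<in> out_darts Y u" for d
  proof -
    have d: "d \<in> darts Y" using that by (simp add: out_darts_def)
    have mor: "morphism Y X p" using cover by (simp add: combinatorial_cover_def)
    show ?thesis
      using mor d Y.flip_in_darts[OF d] Y.head_in_verts[OF d] unfolding morphism_def by metis
  qed
  have bij: "bij_betw (snd p) (out_darts Y u) (out_darts X (fst p u))"
    using cover u by (simp add: combinatorial_cover_def)
  have "(\<Sum>v\<in>?F. shifted_laplacian Y t u v) = t * (\<Sum>v\<in>?F. of_bool (u = v)) +
      (\<Sum>d\<in>out_darts Y u. (\<Sum>v\<in>?F. of_bool (u = v)) - (\<Sum>v\<in>?F. of_bool (head Y d = v)))"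
    unfolding shifted_laplacian_def sum.distrib sum_distrib_left
    by (subst sum.swap) (simp add: sum_subtractf)
  also have "\<dots> = t * of_bool (fst p u = x) +
      (\<Sum>d\<in>out_darts Y u. of_bool (fst p u = x) - of_bool (head X (snd p d) = x))"
    unfolding sum_of_bool_eq[OF F]
    by (intro arg_cong2[where f = "(+)"] arg_cong2[where f = "(*)"] arg_cong2[where f = "(-)"]
      arg_cong[where f = of_bool] sum.cong refl) (use u head in auto)
  also have "\<dots> = shifted_laplacian X t (fst p u) x"
    unfolding shifted_laplacian_def by (subst sum.reindex_bij_betw[OF bij, symmetric]) simp
  finally show ?thesis by simp
qed

section \<open>Determinants on a Klein four cover\<close>

text \<open>The three involutions play the same part, invariance under \<open>c\<close> being a
  consequence, so one computation for the quotient by \<open>a\<close> gives those by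
  \<open>b\<close> and \<open>c\<close> after renaming. The laws in \<open>mult\<close> are global,
  which suits deck transformations: their products are equalities of functions.\<close>

locale klein_four_fibration =
  fixes W :: "'w set" and a b c :: "'w \<Rightarrow> 'w" and \<pi> :: "'w \<Rightarrow> 'v" and M :: "'w \<Rightarrow> 'w \<Rightarrow> real"
  assumes finite_W: "finite W"
    and closed: "w \<in> W \<Longrightarrow> a w \<in> W" "w \<in> W \<Longrightarrow> b w \<in> W" "w \<in> W \<Longrightarrow> c w \<in> W"
    and mult: "a (a w) = w" "b (b w) = w" "c (c w) = w" "a (b w) = c w" "b (a w) = c w"
      "b (c w) = a w" "c (b w) = a w" "a (c w) = b w" "c (a w) = b w"
    and free: "w \<in> W \<Longrightarrow> a w \<noteq> w" "w \<in> W \<Longrightarrow> b w \<noteq> w" "w \<in> W \<Longrightarrow> c w \<noteq> w"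
    and fiber: "u \<in> W \<Longrightarrow> v \<in> W \<Longrightarrow> \<pi> u = \<pi> v \<longleftrightarrow> v \<in> {u, a u, b u, c u}"
    and invariant: "u \<in> W \<Longrightarrow> v \<in> W \<Longrightarrow> M (a u) (a v) = M u v"
      "u \<in> W \<Longrightarrow> v \<in> W \<Longrightarrow> M (b u) (b v) = M u v"
begin

definition lift :: "'v \<Rightarrow> 'w"
  where "lift = inv_into W \<pi>"

text \<open>
  The arguments are the values at \<open>a\<close>, \<open>b\<close>, \<open>c\<close> of a character of the Klein four group.
\<close>

definition twisted_det :: "real \<Rightarrow> real \<Rightarrow> real \<Rightarrow> real"
  where "twisted_det \<alpha> \<beta> \<gamma> = set_det (\<pi> ` W) (\<lambda>x y. M (lift x) (lift y) +
    \<alpha> * M (lift x) (a (lift y)) + \<beta> * M (lift x) (b (lift y)) +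
    \<gamma> * M (lift x) (c (lift y)))"

lemma lift_in: "x \<in> \<pi> ` W \<Longrightarrow> lift x \<in> W"
  and proj_lift: "x \<in> \<pi> ` W \<Longrightarrow> \<pi> (lift x) = x"
  by (simp_all add: lift_def inv_into_into f_inv_into_f)

lemma proj_lift_action:
  assumes "x \<in> \<pi> ` W"
  shows "\<pi> (a (lift x)) = x" "\<pi> (b (lift x)) = x" "\<pi> (c (lift x)) = x"
  using fiber[OF lift_in lift_in] assms fiber closed lift_in proj_lift
  by (metis insertCI)+

text \<open>An involution moves across: \<open>M (a u) v = M (a u) (a (a v)) = M u (a v)\<close>.
  All entries can thus be written with an untranslated lift on the left.\<close>

lemma move_action:
  assumes "u \<in> W" "v \<in> W"
  shows "M (a u) v = M u (a v)" "M (b u) v = M u (b v)" "M (c u) v = M u (c v)"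
proof -
  have a: "M (a u) v = M u (a v)" if "u \<in> W" "v \<in> W" for u v
    using invariant(1)[of u "a v"] that closed by (simp add: mult)
  have b: "M (b u) v = M u (b v)" if "u \<in> W" "v \<in> W" for u v
    using invariant(2)[of u "b v"] that closed by (simp add: mult)
  show "M (a u) v = M u (a v)" "M (b u) v = M u (b v)"
    using a b assms by auto
  show "M (c u) v = M u (c v)"
    using a[of "b u" v] b[of u "a v"] assms closed by (simp add: mult)
qed

text \<open>Coordinates of \<open>W\<close> over its base: the inner Boolean switches
  \<open>a\<close>, the outer one \<open>b\<close>, and both together give \<open>c\<close>. The
  nesting is the one required for using \<open>set_det_double\<close> twice.\<close>

definition coord :: "('v \<times> bool) \<times> bool \<Rightarrow> 'w"
  where "coord = (\<lambda>((x, i), j). (if i then a else id) ((if j then b else id) (lift x)))"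

lemma bij_coord: "bij_betw coord ((\<pi> ` W \<times> UNIV) \<times> UNIV) W"
proof (rule bij_betw_imageI)
  have proj: "\<pi> (coord ((x, i), j)) = x" if "x \<in> \<pi> ` W" for x i j
    using that proj_lift proj_lift_action by (auto simp: coord_def mult)
  have ne: "a w \<noteq> b w" "a w \<noteq> c w" "b w \<noteq> c w" if "w \<in> W" for w
    using free that by (metis mult)+
  show "inj_on coord ((\<pi> ` W \<times> UNIV) \<times> UNIV)"
  proof (rule inj_onI)
    fix k l assume k: "k \<in> (\<pi> ` W \<times> UNIV) \<times> (UNIV :: bool set)"
      and l: "l \<in> (\<pi> ` W \<times> UNIV) \<times> (UNIV :: bool set)" and kl: "coord k = coord l"
    obtain x i j y i' j' where kl_eq: "k = ((x, i), j)" "l = ((y, i'), j')"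
      by (metis surj_pair)
    have x: "x \<in> \<pi> ` W" and "y = x"
      using k l kl proj[of x i j] proj[of y i' j'] by (auto simp: kl_eq)
    note n = ne[OF lift_in[OF x]] free[OF lift_in[OF x]]
    show "k = l"
      using kl n n[symmetric] unfolding kl_eq \<open>y = x\<close> coord_def
      by (cases i; cases j; cases i'; cases j') (simp_all add: mult)
  qed
  show "coord ` ((\<pi> ` W \<times> UNIV) \<times> UNIV) = W"
  proof
    show "coord ` ((\<pi> ` W \<times> UNIV) \<times> UNIV) \<subseteq> W"
      using lift_in closed by (auto simp: coord_def)
    show "W \<subseteq> coord ` ((\<pi> ` W \<times> UNIV) \<times> UNIV)"
    proof
      fix w assume w: "w \<in> W"
      let ?s = "lift (\<pi> w)"
      have "?s \<in> W" "\<pi> ?s = \<pi> w" using w lift_in proj_lift by auto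
      then have "w \<in> {?s, a ?s, b ?s, c ?s}"
        using fiber[of ?s w] w by blast
      moreover have "?s = coord ((\<pi> w, False), False)" "a ?s = coord ((\<pi> w, True), False)"
        "b ?s = coord ((\<pi> w, False), True)" "c ?s = coord ((\<pi> w, True), True)"
        by (simp_all add: coord_def mult)
      ultimately have "\<exists>i j. w = coord ((\<pi> w, i), j)" by (metis insertE emptyE)
      then obtain i j where wc: "w = coord ((\<pi> w, i), j)" by blast
      show "w \<in> coord ` ((\<pi> ` W \<times> UNIV) \<times> UNIV)"
        by (subst wc, rule imageI) (use w in auto)
    qed
  qed
qed

lemma card_total: "card W = 4 * card (\<pi> ` W)"
  using bij_betw_same_card[OF bij_coord] by (simp add: card_cartesian_product)

text \<open>The outer splitting fixes the value of a character at \<open>b\<close>, the inner one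
  its value at \<open>a\<close>; the value at \<open>c\<close> is their product.\<close>

lemma set_det_total:
  "set_det W M =
    twisted_det 1 1 1 * twisted_det 1 (-1) (-1) * twisted_det (-1) 1 (-1) * twisted_det (-1) (-1) 1"
proof -
  let ?V = "\<pi> ` W"
  let ?F = "\<lambda>(g :: 'w \<Rightarrow> 'w) (x :: 'v) (y :: 'v). M (lift x) (g (lift y))"
  let ?P = "\<lambda>g h (k :: 'v \<times> bool) (l :: 'v \<times> bool).
      if snd k = snd l then ?F g (fst k) (fst l) else ?F h (fst k) (fst l)"
  have fin: "finite ?V" "finite (?V \<times> (UNIV :: bool set))"
    using finite_W by auto
  have "set_det W M = set_det ((?V \<times> UNIV) \<times> UNIV) (\<lambda>k l. M (coord k) (coord l))"
    using fin by (intro set_det_reindex[OF bij_coord]) simp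
  \<comment> \<open>An entry depends on the two sheets through the difference of their coordinates:
    equal outer Booleans leave \<open>id\<close> or \<open>a\<close>, different ones
    \<open>b\<close> or \<open>c\<close>.\<close>
  also have "\<dots> = set_det ((?V \<times> UNIV) \<times> UNIV)
      (\<lambda>(u, i :: bool) (v, j). if i = j then ?P id a u v else ?P b c u v)"
    by (rule set_det_cong)
      (auto simp: coord_def move_action lift_in closed mult)
  also have "\<dots> = set_det (?V \<times> UNIV) (\<lambda>u v. ?P id a u v + ?P b c u v) *
      set_det (?V \<times> UNIV) (\<lambda>u v. ?P id a u v - ?P b c u v)"
    by (rule set_det_double[OF fin(2)])
  also have "set_det (?V \<times> UNIV) (\<lambda>u v. ?P id a u v + ?P b c u v) =
      set_det (?V \<times> UNIV) (\<lambda>(x, i :: bool) (y, j).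
        if i = j then ?F id x y + ?F b x y else ?F a x y + ?F c x y)"
    by (rule set_det_cong) auto
  also have "\<dots> = twisted_det 1 1 1 * twisted_det (-1) 1 (-1)"
    unfolding set_det_double[OF fin(1)] twisted_det_def
    by (intro arg_cong2[where f = "(*)"] set_det_cong) auto
  also have "set_det (?V \<times> UNIV) (\<lambda>u v. ?P id a u v - ?P b c u v) =
      set_det (?V \<times> UNIV) (\<lambda>(x, i :: bool) (y, j).
        if i = j then ?F id x y - ?F b x y else ?F a x y - ?F c x y)"
    by (rule set_det_cong) auto
  also have "\<dots> = twisted_det 1 (-1) (-1) * twisted_det (-1) (-1) 1"
    unfolding set_det_double[OF fin(1)] twisted_det_def
    by (intro arg_cong2[where f = "(*)"] set_det_cong) auto
  finally show ?thesis by simp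
qed

text \<open>The sum over the four points above \<open>y\<close> weights all group elements by 1,
  which is the trivial character.\<close>

lemma set_det_base:
  assumes N: "\<And>u x. u \<in> W \<Longrightarrow> N (\<pi> u) x = (\<Sum>v | v \<in> W \<and> \<pi> v = x. M u v)"
  shows "set_det (\<pi> ` W) N = twisted_det 1 1 1"
  unfolding twisted_det_def
proof (rule set_det_cong)
  fix x y assume x: "x \<in> \<pi> ` W" and y: "y \<in> \<pi> ` W"
  let ?s = "lift y"
  have s: "?s \<in> W" using lift_in[OF y] .
  have ne: "a ?s \<noteq> b ?s" "a ?s \<noteq> c ?s" "b ?s \<noteq> c ?s"
    using free s by (metis mult)+
  have "{v \<in> W. \<pi> v = y} = {?s, a ?s, b ?s, c ?s}"
    using fiber[OF s] s closed proj_lift[OF y] proj_lift_action[OF y] by auto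
  moreover have "N x y = (\<Sum>v | v \<in> W \<and> \<pi> v = y. M (lift x) v)"
    using N[OF lift_in[OF x]] proj_lift[OF x] by simp
  ultimately show "N x y = M (lift x) ?s + 1 * M (lift x) (a ?s) +
      1 * M (lift x) (b ?s) + 1 * M (lift x) (c ?s)"
    using ne free[OF s] free[OF s, symmetric] by simp
qed

lemma rotate: "klein_four_fibration W b c a \<pi> M"
proof
  show "M (c u) (c v) = M u v" if "u \<in> W" "v \<in> W" for u v
    using invariant(1)[of "b u" "b v"] invariant(2)[OF that] that closed by (simp add: mult)
  show "\<pi> u = \<pi> v \<longleftrightarrow> v \<in> {u, b u, c u, a u}" if "u \<in> W" "v \<in> W" for u v
    using fiber[OF that] by auto
qed (simp_all add: finite_W closed mult free invariant)

text \<open>In the rotated instance the arguments are the values at \<open>b\<close>,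
  \<open>c\<close>, \<open>a\<close>; in the order \<open>a\<close>, \<open>b\<close>,
  \<open>c\<close> they read \<open>\<gamma>\<close>, \<open>\<alpha>\<close>,
  \<open>\<beta>\<close>.\<close>

lemma twisted_det_rotate:
  "klein_four_fibration.twisted_det W b c a \<pi> M \<alpha> \<beta> \<gamma> = twisted_det \<gamma> \<alpha> \<beta>"
  unfolding twisted_det_def klein_four_fibration.twisted_det_def[OF rotate]
  by (rule set_det_cong) simp

context
  fixes q :: "'w \<Rightarrow> 'u"
  assumes q: "\<And>u v. u \<in> W \<Longrightarrow> v \<in> W \<Longrightarrow> q u = q v \<longleftrightarrow> v \<in> {u, a u}"
begin

text \<open>Each orbit of \<open>a\<close> contains exactly one point whose inner coordinate is
  \<open>False\<close>, that is, \<open>lift x\<close> or \<open>b (lift x)\<close>.\<close>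

lemma bij_quotient:
  "bij_betw (\<lambda>(x, j). q ((if j then b else id) (lift x))) (\<pi> ` W \<times> UNIV) (q ` W)"
    (is "bij_betw ?\<psi> _ _")
proof -
  have eq: "?\<psi> k = q (coord ((fst k, False), snd k))" for k
    by (cases k) (simp add: coord_def)
  have inj: "inj_on coord ((\<pi> ` W \<times> UNIV) \<times> UNIV)" and im: "coord ` ((\<pi> ` W \<times> UNIV) \<times> UNIV) = W"
    using bij_coord by (auto simp: bij_betw_def)
  have a_coord: "a (coord ((x, False), j)) = coord ((x, True), j)" for x j
    by (simp add: coord_def)
  have q_a: "q (a w) = q w" if "w \<in> W" for w
    using q[OF that closed(1)[OF that]] by simp
  show ?thesis
  proof (rule bij_betw_imageI)
    show "inj_on ?\<psi> (\<pi> ` W \<times> UNIV)"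
    proof (rule inj_onI)
      fix k l assume k: "k \<in> \<pi> ` W \<times> (UNIV :: bool set)" and l: "l \<in> \<pi> ` W \<times> (UNIV :: bool set)"
        and "?\<psi> k = ?\<psi> l"
      then have e: "q (coord ((fst k, False), snd k)) = q (coord ((fst l, False), snd l))"
        unfolding eq by simp
      have dom: "((fst m, i), snd m) \<in> (\<pi> ` W \<times> UNIV) \<times> UNIV"
        if "m \<in> \<pi> ` W \<times> (UNIV :: bool set)" for m i
        using that by (cases m) simp
      have mem: "coord ((fst m, False), snd m) \<in> W" if "m \<in> \<pi> ` W \<times> (UNIV :: bool set)" for m
        using imageI[OF dom[OF that], of coord False] unfolding im .
      have "coord ((fst l, False), snd l) = coord ((fst k, False), snd k) \<or>
          coord ((fst l, False), snd l) = coord ((fst k, True), snd k)"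
        using q[OF mem[OF k] mem[OF l]] e a_coord by simp
      then have "((fst l, False), snd l) = ((fst k, False), snd k) \<or>
          ((fst l, False), snd l) = ((fst k, True), snd k)"
        using inj_onD[OF inj _ dom[OF l] dom[OF k]] by blast
      then show "k = l"
        by (simp add: prod_eq_iff)
    qed
    show "?\<psi> ` (\<pi> ` W \<times> UNIV) = q ` W"
    proof
      show "?\<psi> ` (\<pi> ` W \<times> UNIV) \<subseteq> q ` W"
        using lift_in closed by auto
      show "q ` W \<subseteq> ?\<psi> ` (\<pi> ` W \<times> UNIV)"
      proof
        fix y assume "y \<in> q ` W"
        then obtain w where w: "w \<in> W" "y = q w" by auto
        then have "w \<in> coord ` ((\<pi> ` W \<times> UNIV) \<times> UNIV)" using im by simp
        then obtain x i j where x: "x \<in> \<pi> ` W" "w = coord ((x, i), j)" by auto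
        have "coord ((x, False), j) \<in> coord ` ((\<pi> ` W \<times> UNIV) \<times> UNIV)"
          by (rule imageI) (use x in simp)
        then have "q (coord ((x, True), j)) = q (coord ((x, False), j))"
          using q_a[of "coord ((x, False), j)"] im a_coord by simp
        then have "y = q (coord ((x, False), j))"
          using w x by (cases i) simp_all
        then have y: "y = ?\<psi> (x, j)" using eq[of "(x, j)"] by simp
        show "y \<in> ?\<psi> ` (\<pi> ` W \<times> UNIV)"
          unfolding y by (rule imageI) (use x in simp)
      qed
    qed
  qed
qed

lemma card_quotient: "card (q ` W) = 2 * card (\<pi> ` W)"
  using bij_betw_same_card[OF bij_quotient] by (simp add: card_cartesian_product)

text \<open>Summing over the pairs \<open>{v, a v}\<close> leaves a matrix that is circulant in the
  Boolean switched by \<open>b\<close>. Its two factors carry the characters with value 1 at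
  \<open>a\<close>, whose values at \<open>b\<close> and \<open>c\<close> agree.\<close>

lemma set_det_quotient:
  assumes N: "\<And>u x. u \<in> W \<Longrightarrow> N (q u) x = (\<Sum>v | v \<in> W \<and> q v = x. M u v)"
  shows "set_det (q ` W) N = twisted_det 1 1 1 * twisted_det 1 (-1) (-1)"
proof -
  let ?V = "\<pi> ` W"
  let ?F = "\<lambda>(g :: 'w \<Rightarrow> 'w) (x :: 'v) (y :: 'v). M (lift x) (g (lift y))"
  have fin: "finite ?V" using finite_W by simp
  have Nq: "N (q u) (q v) = M u v + M u (a v)" if "u \<in> W" "v \<in> W" for u v
  proof -
    have "q w = q v \<longleftrightarrow> w \<in> {v, a v}" if "w \<in> W" for w
      using q[OF \<open>v \<in> W\<close> that] by metis
    then have "{w \<in> W. q w = q v} = {v, a v}"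
      using that(2) closed(1)[OF that(2)] by blast
    then show ?thesis using N[OF that(1)] free(1)[OF that(2)] by simp
  qed
  have "set_det (q ` W) N = set_det (?V \<times> UNIV) (\<lambda>k l.
      N ((\<lambda>(x, j). q ((if j then b else id) (lift x))) k)
        ((\<lambda>(x, j). q ((if j then b else id) (lift x))) l))"
    using fin by (intro set_det_reindex[OF bij_quotient]) simp
  also have "\<dots> = set_det (?V \<times> UNIV) (\<lambda>(x, i :: bool) (y, j).
      if i = j then ?F id x y + ?F a x y else ?F b x y + ?F c x y)"
    by (rule set_det_cong) (auto simp: Nq move_action lift_in closed mult)
  also have "\<dots> = twisted_det 1 1 1 * twisted_det 1 (-1) (-1)"
    unfolding set_det_double[OF fin] twisted_det_def
    by (intro arg_cong2[where f = "(*)"] set_det_cong) auto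
  finally show ?thesis .
qed

end

end

section \<open>Deck transformations and intermediate covers\<close>

locale finite_connected_cover = Y: finite_multigraph Y + X: finite_multigraph X
  for Y :: "('w, 'c) mgraph" and X :: "('v, 'd) mgraph" +
  fixes p :: "('w, 'c, 'v, 'd) mgraph_map"
  assumes cover: "combinatorial_cover Y X p" and connected: "connected_graph Y"
begin

lemma deckD:
  assumes "s \<in> carrier (deck_group Y p)"
  shows "v \<in> verts Y \<Longrightarrow> fst s v \<in> verts Y"
    and "d \<in> darts Y \<Longrightarrow> snd s d \<in> darts Y"
    and "d \<in> darts Y \<Longrightarrow> org Y (snd s d) = fst s (org Y d)"
    and "d \<in> darts Y \<Longrightarrow> flip Y (snd s d) = snd s (flip Y d)"
    and "v \<in> verts Y \<Longrightarrow> fst p (fst s v) = fst p v"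
    and "d \<in> darts Y \<Longrightarrow> snd p (snd s d) = snd p d"
    and "fst s permutes verts Y" and "snd s permutes darts Y"
  using assms by (auto simp: deck_group_def morphism_def)

lemma cover_inj:
  assumes "d \<in> darts Y" "e \<in> darts Y" "org Y d = org Y e" "snd p d = snd p e"
  shows "d = e"
proof -
  have "inj_on (snd p) (out_darts Y (org Y d))"
    using cover Y.org_in_verts[OF assms(1)] by (simp add: combinatorial_cover_def bij_betw_def)
  then show ?thesis
    using assms by (auto simp: out_darts_def dest: inj_onD)
qed

text \<open>An automorphism is a cover with one-point fibres, so
  \<open>shifted_laplacian_cover\<close> also yields the invariance of the Laplacian.\<close>

lemma deck_cover:
  assumes s: "s \<in> carrier (deck_group Y p)"
  shows "combinatorial_cover Y Y s"
  unfolding combinatorial_cover_def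
proof (intro conjI ballI)
  show "morphism Y Y s" using s by (simp add: deck_group_def)
  show "fst s ` verts Y = verts Y" using deckD(7)[OF s] by (rule permutes_image)
  fix w assume w: "w \<in> verts Y"
  show "bij_betw (snd s) (out_darts Y w) (out_darts Y (fst s w))"
  proof (rule bij_betw_imageI)
    show "inj_on (snd s) (out_darts Y w)"
      using permutes_inj[OF deckD(8)[OF s]] by (rule inj_on_subset) simp
    show "snd s ` out_darts Y w = out_darts Y (fst s w)"
    proof
      show "snd s ` out_darts Y w \<subseteq> out_darts Y (fst s w)"
        using deckD[OF s] by (auto simp: out_darts_def)
      show "out_darts Y (fst s w) \<subseteq> snd s ` out_darts Y w"
      proof
        fix e assume e: "e \<in> out_darts Y (fst s w)"
        then have "e \<in> snd s ` darts Y"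
          using permutes_image[OF deckD(8)[OF s]] by (simp add: out_darts_def)
        then obtain d where d: "d \<in> darts Y" "e = snd s d" by auto
        then have "fst s (org Y d) = fst s w"
          using e deckD(3)[OF s] by (simp add: out_darts_def)
        then have "org Y d = w"
          using permutes_inj[OF deckD(7)[OF s]] by (simp add: inj_eq)
        then show "e \<in> snd s ` out_darts Y w"
          using d by (auto simp: out_darts_def)
      qed
    qed
  qed
qed

lemma deck_invariant:
  assumes s: "s \<in> carrier (deck_group Y p)" and uv: "u \<in> verts Y" "v \<in> verts Y"
  shows "shifted_laplacian Y t (fst s u) (fst s v) = shifted_laplacian Y t u v"
proof -
  have "{w. w \<in> verts Y \<and> fst s w = fst s v} = {v}"
    using permutes_inj[OF deckD(7)[OF s]] uv by (auto simp: inj_eq)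
  then show ?thesis
    using shifted_laplacian_cover[OF Y.finite_multigraph_axioms deck_cover[OF s] uv(1), of t "fst s v"]
    by simp
qed

text \<open>Uniqueness of lifts: a dart of the walk and its image under \<open>s\<close> lie over
  the same dart of \<open>X\<close>, and they start at the same vertex once that vertex is
  fixed.\<close>

lemma deck_fixes_walk:
  assumes s: "s \<in> carrier (deck_group Y p)" and "walk Y u ds v" "fst s u = u"
  shows "fst s v = v"
  using assms(2,3)
proof (induction ds arbitrary: u)
  case (Cons d ds)
  then have d: "d \<in> darts Y" "org Y d = u" by auto
  have "snd s d = d"
    by (rule cover_inj) (use d Cons.prems deckD[OF s] in auto)
  then have "fst s (head Y d) = head Y d"
    using deckD(3)[OF s Y.flip_in_darts[OF d(1)]] deckD(4)[OF s d(1)] by simp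
  then show ?case using Cons by auto
qed simp

text \<open>Connectedness spreads the fixed vertex to all vertices, and \<open>cover_inj\<close>
  then fixes all darts. Outside the graph \<open>permutes\<close> makes both maps trivial.\<close>

lemma deck_free:
  assumes s: "s \<in> carrier (deck_group Y p)" and w: "w \<in> verts Y" and "fst s w = w"
  shows "s = (id, id)"
proof -
  have v: "fst s v = v" if "v \<in> verts Y" for v
    using deck_fixes_walk[OF s _ \<open>fst s w = w\<close>] connected w that
    unfolding connected_graph_def by blast
  have d: "snd s d = d" if "d \<in> darts Y" for d
    by (rule cover_inj) (use that v deckD[OF s] Y.org_in_verts in auto)
  have "fst s = id"
    using v permutes_not_in[OF deckD(7)[OF s]] by fastforce
  moreover have "snd s = id"
    using d permutes_not_in[OF deckD(8)[OF s]] by fastforce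
  ultimately show ?thesis by (simp add: prod_eq_iff)
qed

section \<open>The quotient by a deck involution\<close>

context
  fixes s :: "('w, 'c, 'w, 'c) mgraph_map"
  assumes s: "s \<in> carrier (deck_group Y p)"
    and fst_invol: "\<And>v. fst s (fst s v) = v" and snd_invol: "\<And>d. snd s (snd s d) = d"
begin

abbreviation "quot \<equiv> quotient_graph Y {(id, id), s}"

abbreviation "proj \<equiv> (\<lambda>v. {v, fst s v}, \<lambda>d. {d, snd s d})"

lemma quot_simps:
  "verts quot = fst proj ` verts Y" "darts quot = snd proj ` darts Y"
  "d \<in> darts Y \<Longrightarrow> org quot {d, snd s d} = {org Y d, fst s (org Y d)}"
  "d \<in> darts Y \<Longrightarrow> flip quot {d, snd s d} = {flip Y d, snd s (flip Y d)}"
proof -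
  have "{fst r v | r. r \<in> {(id, id), s}} = (\<lambda>r. fst r v) ` {(id, id), s}" for v by blast
  then show "verts quot = fst proj ` verts Y" by (simp add: quotient_graph_def)
  have "{snd r d | r. r \<in> {(id, id), s}} = (\<lambda>r. snd r d) ` {(id, id), s}" for d by blast
  then show "darts quot = snd proj ` darts Y" by (simp add: quotient_graph_def)
qed (use deckD(3,4)[OF s] in \<open>auto simp: quotient_graph_def\<close>)

lemma fst_proj_eq_iff: "fst proj u = fst proj v \<longleftrightarrow> v \<in> {u, fst s u}"
  using fst_invol[of u] fst_invol[of v] by (auto simp: doubleton_eq_iff)

text \<open>The delicate axiom is \<open>flip_neq\<close>: a dart whose flip lies in its own orbit
  would map to a dart of \<open>X\<close> equal to its flip, because \<open>s\<close> acts over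
  \<open>X\<close>.\<close>

lemma finite_multigraph_quot: "finite_multigraph quot"
proof
  fix D assume "D \<in> darts quot"
  then obtain d where d: "d \<in> darts Y" "D = {d, snd s d}" by (auto simp: quot_simps)
  note f = Y.flip_in_darts[OF d(1)]
  show "org quot D \<in> verts quot"
    using d Y.org_in_verts by (auto simp: quot_simps)
  show "flip quot D \<in> darts quot"
    using d f by (auto simp: quot_simps)
  show "flip quot (flip quot D) = D"
    using d f by (simp add: quot_simps Y.flip_flip)
  show "flip quot D \<noteq> D"
  proof
    assume "flip quot D = D"
    then have "{flip Y d, snd s (flip Y d)} = {d, snd s d}"
      using d by (simp add: quot_simps)
    then have "flip Y d = d \<or> flip Y d = snd s d"
      by (auto simp: doubleton_eq_iff)
    then have "snd p (flip Y d) = snd p d"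
      using deckD(6)[OF s d(1)] by auto
    moreover have "snd p d \<in> darts X" "flip X (snd p d) = snd p (flip Y d)"
      using cover d by (auto simp: combinatorial_cover_def morphism_def)
    ultimately show False using X.flip_neq by simp
  qed
qed (simp_all add: quot_simps Y.finite_verts Y.finite_darts)

text \<open>Every orbit of darts leaving the orbit of \<open>w\<close> has exactly one member at
  \<open>w\<close>. Two would have the same image in \<open>X\<close>, against
  \<open>cover_inj\<close>; if a representative leaves the other vertex, \<open>s\<close> moves it
  to \<open>w\<close>.\<close>

lemma cover_quot: "combinatorial_cover Y quot proj"
  unfolding combinatorial_cover_def
proof (intro conjI ballI)
  show "morphism Y quot proj"
    by (auto simp: morphism_def quot_simps)
  show "fst proj ` verts Y = verts quot"
    by (simp add: quot_simps)
  fix w assume w: "w \<in> verts Y"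
  show "bij_betw (snd proj) (out_darts Y w) (out_darts quot (fst proj w))"
  proof (rule bij_betw_imageI)
    show "inj_on (snd proj) (out_darts Y w)"
    proof (rule inj_onI)
      fix d e assume d: "d \<in> out_darts Y w" and e: "e \<in> out_darts Y w" and "snd proj d = snd proj e"
      then have "e = d \<or> e = snd s d" by (auto simp: doubleton_eq_iff)
      then have "snd p d = snd p e"
        using d deckD(6)[OF s] by (auto simp: out_darts_def)
      then show "d = e"
        using d e cover_inj[of d e] by (simp add: out_darts_def)
    qed
    show "snd proj ` out_darts Y w = out_darts quot (fst proj w)"
    proof
      show "snd proj ` out_darts Y w \<subseteq> out_darts quot (fst proj w)"
        by (auto simp: out_darts_def quot_simps)
      show "out_darts quot (fst proj w) \<subseteq> snd proj ` out_darts Y w"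
      proof
        fix D assume D: "D \<in> out_darts quot (fst proj w)"
        then obtain d where d: "d \<in> darts Y" "D = {d, snd s d}"
          by (auto simp: out_darts_def quot_simps)
        have "fst proj (org Y d) = fst proj w"
          using D d by (simp add: out_darts_def quot_simps)
        then have "w = org Y d \<or> w = fst s (org Y d)"
          unfolding fst_proj_eq_iff by simp
        then show "D \<in> snd proj ` out_darts Y w"
        proof
          assume "w = org Y d"
          then show ?thesis using d by (auto simp: out_darts_def)
        next
          assume "w = fst s (org Y d)"
          then have "snd s d \<in> out_darts Y w"
            using d deckD[OF s] by (simp add: out_darts_def)
          moreover have "D = snd proj (snd s d)"
            using d by (auto simp: snd_invol)
          ultimately show ?thesis by blast
        qed
      qed
    qed
  qed
qed

end

end

text \<open>Cancellation excludes \<open>\<one>\<close>, \<open>a\<close> and \<open>b\<close> as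
  values of the product, and one element is left.\<close>

lemma (in group) klein_four_mult:
  assumes "carrier G = {\<one>, a, b, c}" "distinct [\<one>, a, b, c]" "a \<otimes> a = \<one>" "b \<otimes> b = \<one>"
  shows "a \<otimes> b = c"
proof -
  have a: "a \<in> carrier G" and b: "b \<in> carrier G"
    unfolding assms(1) by auto
  have "a \<otimes> b \<noteq> \<one>"
  proof
    assume "a \<otimes> b = \<one>"
    then have "a \<otimes> (a \<otimes> b) = a" using a by simp
    then have "b = a" using a b assms(3) by (simp flip: m_assoc)
    then show False using assms(2) by simp
  qed
  moreover have "a \<otimes> b \<noteq> a" "a \<otimes> b \<noteq> b"
    using a b assms(2) by (auto simp: l_cancel_one r_cancel_one)
  moreover have "a \<otimes> b \<in> {\<one>, a, b, c}"
    using m_closed[OF a b] assms(1) by simp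
  ultimately show ?thesis by blast
qed

lemma (in group) order_two_subgroup:
  assumes "subgroup H G" "card H = 2"
  obtains h where "H = {\<one>, h}" "h \<in> carrier G" "h \<noteq> \<one>" "h \<otimes> h = \<one>"
proof -
  interpret H: subgroup H G by fact
  obtain x y where "H = {x, y}" "x \<noteq> y" using assms(2) by (meson card_2_iff)
  then obtain h where h: "H = {\<one>, h}" "h \<noteq> \<one>"
    using H.one_closed by auto
  then have "h \<in> carrier G" "h \<otimes> h \<in> {\<one>, h}"
    using H.subset H.m_closed[of h h] by auto
  moreover have "h \<otimes> h \<noteq> h"
    using \<open>h \<in> carrier G\<close> h(2) by (simp add: l_cancel_one')
  ultimately show ?thesis using that h by blast
qed

text \<open>Cancels a power of \<open>t\<close> at the one point where it vanishes: \<open>f\<close>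
  is zero on a punctured neighbourhood, hence by continuity also at 0.\<close>

lemma isCont_zero_factor:
  fixes f :: "real \<Rightarrow> real"
  assumes "isCont f 0" "\<And>t. t ^ n * f t = 0"
  shows "f 0 = 0"
proof -
  have "f t = 0" if "t \<noteq> 0" for t
    using assms(2)[of t] that by simp
  then have "eventually (\<lambda>t. f t = 0) (at 0)"
    unfolding eventually_at_filter by (intro always_eventually) simp
  with assms(1) have "((\<lambda>t::real. 0) \<longlongrightarrow> f 0) (at 0)"
    unfolding isCont_def by (rule Lim_transform_eventually)
  then show ?thesis using LIM_const_eq by metis
qed

theorem theorem3p6:
  fixes X :: "('v, 'd) mgraph" and Y :: "('w, 'c) mgraph"
    and p :: "('w, 'c, 'v, 'd) mgraph_map"
    and H2 H3 H4 :: "('w, 'c, 'w, 'c) mgraph_map set"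
    and X2 X3 X4 :: "('w set, 'c set) mgraph"
  assumes "finite_multigraph X" and "connected_graph X" and "\<forall>v\<in>verts X. vdegree X v \<noteq> 1"
    and "finite_multigraph Y" and "connected_graph Y" and "\<forall>w\<in>verts Y. vdegree Y w \<noteq> 1"
    and "abelian_cover Y X p"
    and "deck_group Y p \<cong> integer_mod_group 2 \<times>\<times> integer_mod_group 2"
    and "{H. subgroup H (deck_group Y p) \<and> card H = 2} = {H2, H3, H4}"
    and "distinct [H2, H3, H4]"
    and "X2 = quotient_graph Y H2" and "X3 = quotient_graph Y H3" and "X4 = quotient_graph Y H4"
  shows "real (kappa Y) =
    2 * (real (kappa X2) * real (kappa X3) * real (kappa X4) / (real (kappa X))\<^sup>2)"
proof -
  let ?G = "deck_group Y p"
  have galois: "galois_cover Y X p" and "comm_group ?G"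
    using assms(7) by (auto simp: abelian_cover_def)
  interpret Y: finite_multigraph Y by fact
  interpret X: finite_multigraph X by fact
  interpret G: comm_group ?G by fact
  have "combinatorial_cover Y X p"
    using graph_cover_imp_combinatorial[OF Y.multigraph_axioms X.multigraph_axioms] galois
    by (simp add: galois_cover_def)
  then interpret finite_connected_cover Y X p
    using assms(5) by unfold_locales
  \<comment> \<open>Transitivity is given on the points of the realization; a vertex is such a
    point, and \<open>realization_map s\<close> moves it by \<open>fst s\<close>.\<close>
  have transitive: "\<exists>s\<in>carrier ?G. fst s u = v"
    if "u \<in> verts Y" "v \<in> verts Y" "fst p u = fst p v" for u v
  proof -
    have "Vertex u \<in> topspace (realization Y)" "Vertex v \<in> topspace (realization Y)"
      using that by (simp_all add: topspace_realization Y.Vertex_in_points_iff)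
    moreover have "realization_map p (Vertex u) = realization_map p (Vertex v)"
      using that by simp
    ultimately obtain s where "s \<in> carrier ?G" "realization_map s (Vertex u) = Vertex v"
      using galois unfolding galois_cover_def by blast
    then show ?thesis by auto
  qed
  have one: "\<one>\<^bsub>?G\<^esub> = (id, id)" by (simp add: deck_group_def)
  have mult: "fst (g \<otimes>\<^bsub>?G\<^esub> h) = fst g \<circ> fst h" "snd (g \<otimes>\<^bsub>?G\<^esub> h) = snd g \<circ> snd h" for g h
    by (simp_all add: deck_group_def)
  have card_G: "card (carrier ?G) = 4"
    using iso_same_card[OF assms(8)]
    by (simp add: carrier_integer_mod_group card_cartesian_product DirProd_def)
  have sub: "subgroup H2 ?G" "card H2 = 2" "subgroup H3 ?G" "card H3 = 2" "subgroup H4 ?G" "card H4 = 2"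
    using assms(9) by auto
  obtain a where a: "H2 = {\<one>\<^bsub>?G\<^esub>, a}" "a \<in> carrier ?G" "a \<noteq> \<one>\<^bsub>?G\<^esub>" "a \<otimes>\<^bsub>?G\<^esub> a = \<one>\<^bsub>?G\<^esub>"
    using G.order_two_subgroup[OF sub(1,2)] .
  obtain b where b: "H3 = {\<one>\<^bsub>?G\<^esub>, b}" "b \<in> carrier ?G" "b \<noteq> \<one>\<^bsub>?G\<^esub>" "b \<otimes>\<^bsub>?G\<^esub> b = \<one>\<^bsub>?G\<^esub>"
    using G.order_two_subgroup[OF sub(3,4)] .
  obtain c where c: "H4 = {\<one>\<^bsub>?G\<^esub>, c}" "c \<in> carrier ?G" "c \<noteq> \<one>\<^bsub>?G\<^esub>" "c \<otimes>\<^bsub>?G\<^esub> c = \<one>\<^bsub>?G\<^esub>"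
    using G.order_two_subgroup[OF sub(5,6)] .
  have dist: "distinct [\<one>\<^bsub>?G\<^esub>, a, b, c]"
    using assms(10) a b c by auto
  have "{\<one>\<^bsub>?G\<^esub>, a, b, c} = carrier ?G"
  proof (rule card_subset_eq)
    show "finite (carrier ?G)" using card_G card.infinite by fastforce
    show "card {\<one>\<^bsub>?G\<^esub>, a, b, c} = card (carrier ?G)"
      using distinct_card[OF dist] card_G by simp
  qed (use a b c in auto)
  then have car: "carrier ?G = {\<one>\<^bsub>?G\<^esub>, a, b, c}" by simp
  \<comment> \<open>\<open>klein_four_mult\<close> yields one product for each ordering of
    \<open>a\<close>, \<open>b\<close>, \<open>c\<close>; these orderings supply the other
    five.\<close>
  have perms: "carrier ?G = {\<one>\<^bsub>?G\<^esub>, a, c, b}" "carrier ?G = {\<one>\<^bsub>?G\<^esub>, b, c, a}"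
    "carrier ?G = {\<one>\<^bsub>?G\<^esub>, b, a, c}" "carrier ?G = {\<one>\<^bsub>?G\<^esub>, c, a, b}" "carrier ?G = {\<one>\<^bsub>?G\<^esub>, c, b, a}"
    using car by auto
  have prods: "a \<otimes>\<^bsub>?G\<^esub> b = c" "a \<otimes>\<^bsub>?G\<^esub> c = b" "b \<otimes>\<^bsub>?G\<^esub> c = a"
    "b \<otimes>\<^bsub>?G\<^esub> a = c" "c \<otimes>\<^bsub>?G\<^esub> a = b" "c \<otimes>\<^bsub>?G\<^esub> b = a"
    using G.klein_four_mult[OF car] G.klein_four_mult[OF perms(1)] G.klein_four_mult[OF perms(2)]
      G.klein_four_mult[OF perms(3)] G.klein_four_mult[OF perms(4)] G.klein_four_mult[OF perms(5)]
      dist a(4) b(4) c(4) by auto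
  have fst_mult: "fst g (fst h v) = fst (g \<otimes>\<^bsub>?G\<^esub> h) v"
    and snd_mult: "snd g (snd h d) = snd (g \<otimes>\<^bsub>?G\<^esub> h) d" for g h v d
    by (simp_all add: mult)
  have free: "fst s w \<noteq> w" if "s \<in> carrier ?G" "s \<noteq> \<one>\<^bsub>?G\<^esub>" "w \<in> verts Y" for s w
    using deck_free[OF that(1,3)] that(2) one by metis
  have fiber: "fst p u = fst p v \<longleftrightarrow> v \<in> {u, fst a u, fst b u, fst c u}"
    if "u \<in> verts Y" "v \<in> verts Y" for u v
  proof
    assume "fst p u = fst p v"
    then obtain s where "s \<in> carrier ?G" "fst s u = v" using transitive \<open>u \<in> verts Y\<close> \<open>v \<in> verts Y\<close> by blast
    then show "v \<in> {u, fst a u, fst b u, fst c u}"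
      unfolding car by (auto simp: one)
  next
    assume "v \<in> {u, fst a u, fst b u, fst c u}"
    then show "fst p u = fst p v"
      using deckD(5)[OF a(2) that(1)] deckD(5)[OF b(2) that(1)] deckD(5)[OF c(2) that(1)] by auto
  qed
  have kf: "klein_four_fibration (verts Y) (fst a) (fst b) (fst c) (fst p) (shifted_laplacian Y t)" for t
    by unfold_locales
      (use Y.finite_verts deckD(1)[OF a(2)] deckD(1)[OF b(2)] deckD(1)[OF c(2)] free a b c fiber
        deck_invariant in \<open>simp_all add: fst_mult prods one\<close>)
  \<comment> \<open>The quotient results concern the involution named first, so one rotation
    prepares \<open>X3\<close> and a second one \<open>X4\<close>.\<close>
  note kf_b = klein_four_fibration.rotate[OF kf]
  note kf_c = klein_four_fibration.rotate[OF kf_b]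
  let ?V = "verts X" and ?D = "\<lambda>t. klein_four_fibration.twisted_det (verts Y) (fst a) (fst b) (fst c)
      (fst p) (shifted_laplacian Y t)"
  have V: "fst p ` verts Y = ?V" using cover by (simp add: combinatorial_cover_def)
  have detY: "set_det (verts Y) (shifted_laplacian Y t) =
      ?D t 1 1 1 * ?D t 1 (-1) (-1) * ?D t (-1) 1 (-1) * ?D t (-1) (-1) 1" for t
    by (rule klein_four_fibration.set_det_total[OF kf])
  have detX: "set_det ?V (shifted_laplacian X t) = ?D t 1 1 1" for t
    unfolding V[symmetric]
    by (rule klein_four_fibration.set_det_base[OF kf])
      (rule shifted_laplacian_cover[OF Y.finite_multigraph_axioms cover])
  have quot: "finite_multigraph (quotient_graph Y {\<one>\<^bsub>?G\<^esub>, s})"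
    "card (verts (quotient_graph Y {\<one>\<^bsub>?G\<^esub>, s})) = 2 * card ?V"
    "set_det (verts (quotient_graph Y {\<one>\<^bsub>?G\<^esub>, s}))
        (shifted_laplacian (quotient_graph Y {\<one>\<^bsub>?G\<^esub>, s}) t) =
      klein_four_fibration.twisted_det (verts Y) (fst s) f g (fst p) (shifted_laplacian Y t) 1 1 1 *
      klein_four_fibration.twisted_det (verts Y) (fst s) f g (fst p) (shifted_laplacian Y t) 1 (-1) (-1)"
    if s: "s \<in> carrier ?G" "s \<otimes>\<^bsub>?G\<^esub> s = \<one>\<^bsub>?G\<^esub>"
      and fib: "klein_four_fibration (verts Y) (fst s) f g (fst p) (shifted_laplacian Y t)" for s f g t
  proof -
    let ?q = "\<lambda>v. {v, fst s v}"
    have inv: "fst s (fst s v) = v" "snd s (snd s d) = d" for v d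
      by (simp_all add: fst_mult snd_mult s(2) one)
    show "finite_multigraph (quotient_graph Y {\<one>\<^bsub>?G\<^esub>, s})"
      unfolding one by (rule finite_multigraph_quot[OF s(1) inv])
    note cov = cover_quot[OF s(1) inv]
    have verts: "verts (quotient_graph Y {\<one>\<^bsub>?G\<^esub>, s}) = ?q ` verts Y"
      using cov unfolding one by (simp add: combinatorial_cover_def)
    have q: "?q u = ?q v \<longleftrightarrow> v \<in> {u, fst s u}" for u v
      using inv(1)[of u] inv(1)[of v] by (auto simp: doubleton_eq_iff)
    show "card (verts (quotient_graph Y {\<one>\<^bsub>?G\<^esub>, s})) = 2 * card ?V"
      unfolding verts V[symmetric] by (rule klein_four_fibration.card_quotient[OF fib]) (rule q)
    show "set_det (verts (quotient_graph Y {\<one>\<^bsub>?G\<^esub>, s}))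
        (shifted_laplacian (quotient_graph Y {\<one>\<^bsub>?G\<^esub>, s}) t) =
      klein_four_fibration.twisted_det (verts Y) (fst s) f g (fst p) (shifted_laplacian Y t) 1 1 1 *
      klein_four_fibration.twisted_det (verts Y) (fst s) f g (fst p) (shifted_laplacian Y t) 1 (-1) (-1)"
      unfolding verts
    proof (rule klein_four_fibration.set_det_quotient[OF fib])
      show "?q u = ?q v \<longleftrightarrow> v \<in> {u, fst s u}" for u v by (rule q)
      show "shifted_laplacian (quotient_graph Y {\<one>\<^bsub>?G\<^esub>, s}) t {u, fst s u} x =
          (\<Sum>v | v \<in> verts Y \<and> {v, fst s v} = x. shifted_laplacian Y t u v)"
        if "u \<in> verts Y" for u x
        using shifted_laplacian_cover[OF Y.finite_multigraph_axioms cov that, of t x]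
        unfolding one by simp
    qed
  qed
  note quot2 = quot[OF a(2,4) kf, folded a(1) assms(11)]
  note quot3 = quot[OF b(2,4) kf_b, folded b(1) assms(12)]
  note quot4 = quot[OF c(2,4) kf_c, folded c(1) assms(13)]
  \<comment> \<open>In common coordinates the nontrivial factor (1, -1, -1) becomes (-1, 1, -1) for
    \<open>X3\<close> and (-1, -1, 1) for \<open>X4\<close>: the characters with value 1 at
    \<open>b\<close> and at \<open>c\<close>.\<close>
  have rot: "klein_four_fibration.twisted_det (verts Y) (fst b) (fst c) (fst a) (fst p)
      (shifted_laplacian Y t) \<alpha> \<beta> \<gamma> = ?D t \<gamma> \<alpha> \<beta>"
    "klein_four_fibration.twisted_det (verts Y) (fst c) (fst a) (fst b) (fst p)
      (shifted_laplacian Y t) \<alpha> \<beta> \<gamma> = ?D t \<beta> \<gamma> \<alpha>" for t \<alpha> \<beta> \<gamma>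
    by (simp_all add: klein_four_fibration.twisted_det_rotate[OF kf]
        klein_four_fibration.twisted_det_rotate[OF kf_b])
  let ?n = "card ?V"
  have n: "?n > 0"
    using assms(2) X.finite_verts by (simp add: connected_graph_def card_gt_0_iff)
  have card_Y: "card (verts Y) = 4 * ?n"
    using klein_four_fibration.card_total[OF kf] V by simp
  have factor: "\<exists>Q :: real \<Rightarrow> real. (\<forall>t. set_det (verts Z) (shifted_laplacian Z t) = t * Q t) \<and>
      isCont Q 0 \<and> Q 0 = real (card (verts Z) * kappa Z)"
    if "finite_multigraph Z" "card (verts Z) > 0" for Z :: "('x, 'y) mgraph"
    by (rule finite_multigraph.set_det_shifted_laplacian_factor) (use that in auto)
  obtain QY where QY: "\<And>t. set_det (verts Y) (shifted_laplacian Y t) = t * QY t"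
      "isCont QY 0" "QY 0 = real (card (verts Y) * kappa Y)"
    using factor[OF Y.finite_multigraph_axioms] card_Y n by auto
  obtain QX where QX: "\<And>t. set_det ?V (shifted_laplacian X t) = t * QX t"
      "isCont QX 0" "QX 0 = real (?n * kappa X)"
    using factor[OF X.finite_multigraph_axioms n] by auto
  obtain Q2 where Q2: "\<And>t. set_det (verts X2) (shifted_laplacian X2 t) = t * Q2 t"
      "isCont Q2 0" "Q2 0 = real (2 * ?n * kappa X2)"
    using factor[OF quot2(1)] quot2(2) n by auto
  obtain Q3 where Q3: "\<And>t. set_det (verts X3) (shifted_laplacian X3 t) = t * Q3 t"
      "isCont Q3 0" "Q3 0 = real (2 * ?n * kappa X3)"
    using factor[OF quot3(1)] quot3(2) n by auto
  obtain Q4 where Q4: "\<And>t. set_det (verts X4) (shifted_laplacian X4 t) = t * Q4 t"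
      "isCont Q4 0" "Q4 0 = real (2 * ?n * kappa X4)"
    using factor[OF quot4(1)] quot4(2) n by auto
  have "QY 0 * (QX 0)\<^sup>2 - Q2 0 * Q3 0 * Q4 0 = 0"
  proof (rule isCont_zero_factor[of "\<lambda>t. QY t * (QX t)\<^sup>2 - Q2 t * Q3 t * Q4 t" 3])
    show "isCont (\<lambda>t. QY t * (QX t)\<^sup>2 - Q2 t * Q3 t * Q4 t) 0"
      using QY(2) QX(2) Q2(2) Q3(2) Q4(2) by (intro continuous_intros)
    show "t ^ 3 * (QY t * (QX t)\<^sup>2 - Q2 t * Q3 t * Q4 t) = 0" for t
    proof -
      \<comment> \<open>Both sides contain the factor of the trivial character three times and each
        of the other three factors once.\<close>
      have "(t * QY t) * (t * QX t)\<^sup>2 = (t * Q2 t) * (t * Q3 t) * (t * Q4 t)"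
        unfolding QY(1)[symmetric] QX(1)[symmetric] Q2(1)[symmetric] Q3(1)[symmetric] Q4(1)[symmetric]
          detY detX quot2(3) quot3(3) quot4(3) rot
        by (simp add: power2_eq_square)
      then show ?thesis
        by (simp add: algebra_simps power2_eq_square power3_eq_cube)
    qed
  qed
  \<comment> \<open>The vertex counts are 4n times n^2 on the left and (2n)^3 on the right;
    cancelling 4 leaves the constant 2.\<close>
  then have "real ?n ^ 3 * (real (kappa Y) * (real (kappa X))\<^sup>2) =
      real ?n ^ 3 * (2 * (real (kappa X2) * real (kappa X3) * real (kappa X4)))"
    unfolding QY(3) QX(3) Q2(3) Q3(3) Q4(3) card_Y
    by (simp add: algebra_simps power2_eq_square power3_eq_cube)
  then have "real (kappa Y) * (real (kappa X))\<^sup>2 =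
      2 * (real (kappa X2) * real (kappa X3) * real (kappa X4))"
    by (rule mult_left_cancel[THEN iffD1, rotated]) (use n in simp)
  moreover have "real (kappa X) \<noteq> 0"
    using X.kappa_pos[OF assms(2)] by simp
  ultimately show ?thesis
    by (simp add: field_simps)
qed

end
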